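(* Let $\mathcal V$ be a normed $\mathcal R$-module and let $F\in\mathcal V'$ be tight (with respect to $\mathcal R$). Then there exists a unique local vector measure $\mathsf N_F$ defined on $\mathcal V$ such that $$\mathsf N_F(X)(v)=F(v)\qquad\text{for every }v\in\mathcal V.$$ Moreover $|\mathsf N_F|=\mu$, where $\mu$ is the finite Borel measure on $X$ whose value on every open set $A\subseteq X$ is $$\mu(A)=\sup\{F(v):v\in\mathcal V,\ \|v\|\le1,\ \operatorname{supp}v\subseteq A\}.$$
   Context: $(X,\tau)$ is a Polish space, $\mathcal B(X)$ its Borel $\sigma$-algebra, $C_b(X)$ the ring of bounded continuous real functions on $X$ with the sup norm $\|\cdot\|_\infty$. A subring $\mathcal R\subseteq C_b(X)$ (containing the unity) approximates open sets if it is a lattice, is closed under multiplication by constants, and for every open $A\subseteq X$ there is a sequence $\{f_k\}_k\subseteq\mathcal R$ with $f_k(x)\nearrow\chi_A(x)$ for every $x\in X$. A normed $\mathcal R$-module (where $\mathcal R$ is always assumed to approximate open sets) is a normed real vector space $(\mathcal V,\|\cdot\|)$ that is also a module over the ring $\mathcal R$ in the algebraic sense and satisfies $\|f_1v_1+\dots+f_nv_n\|\le\max_i\|f_i\|_\infty\max_i\|v_i\|$ whenever $v_1,\dots,v_n\in\mathcal V$ and $f_1,\dots,f_n\in\mathcal R$ have pairwise disjoint supports. For $A\subseteq X$ open and $v\in\mathcal V$ set $\|v\|_{|A}:=\sup\{\|fv\|:f\in\mathcal R,\ \operatorname{supp}f\subseteq A,\ \|f\|_\infty\le1\}$. For $C\subseteq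 X$ closed, $\operatorname{supp}v\subseteq C$ means $\|v\|_{|X\setminus C}=0$; for $B\subseteq X$ Borel, $\operatorname{supp}v\subseteq B$ means $\operatorname{supp}v\subseteq C$ for some closed $C\subseteq B$. $(\mathcal V',\|\cdot\|')$ is the dual normed space of $\mathcal V$. A $\mathcal V'$-valued measure is a map $\mathsf N:\mathcal B(X)\to\mathcal V'$ that is $\sigma$-additive, with convergence of the series in the norm of $\mathcal V'$. A local vector measure defined on $\mathcal V$ is a $\mathcal V'$-valued measure that is weakly local: $\mathsf N(A)(v)=0$ for every $A\subseteq X$ open and $v\in\mathcal V$ with $\|v\|_{|A}=0$. The total variation of $\mathsf N$ is the Borel measure $|\mathsf N|(E):=\sup_\pi\sum_{A\in\pi}\|\mathsf N(A)\|'$, the supremum being over all finite Borel partitions $\pi$ of $E$. $F\in\mathcal V'$ is tight with respect to $\mathcal R$ if $F(\varphi_nv)\to0$ for every $v\in\mathcal V$ and every sequence $\{\varphi_n\}_n\subseteq\mathcal R$ with $\varphi_n(x)\searrow0$ for every $x\in X$. For $F\in\mathcal V'$, tightness of $F$ is equivalent to the set function $A\mapsto\sup\{F(v):v\in\mathcal V,\|v\|\le1,\operatorname{supp}v\subseteq A\}$ being the restriction to open sets of a finite Borel measure (so that the measure $\mu$ in the claim is well defined). *)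

theory Defs
  imports "HOL-Analysis.Analysis"
begin

definition fsupp :: "('x::topological_space \<Rightarrow> real) \<Rightarrow> 'x set"
  where "fsupp f = closure {x. f x \<noteq> 0}"

text \<open>Real-valued supremum, meant for bounded \<open>f\<close>; it agrees with the norm of the library type
  of bounded continuous functions.\<close>

definition sup_norm :: "('x \<Rightarrow> real) \<Rightarrow> real"
  where "sup_norm f = (SUP x. \<bar>f x\<bar>)"

text \<open>Elements of the ring are kept as plain functions with pointwise operations, since the library
  type of bounded continuous functions carries no multiplication or lattice structure.\<close>

locale approximating_subring =
  fixes R :: "('x::topological_space \<Rightarrow> real) set"
  assumes subset_Cb: "R \<subseteq> bcontfun"
    and one_mem: "(\<lambda>_. 1) \<in> R"
    and add_mem: "f \<in> R \<Longrightarrow> g \<in> R \<Longrightarrow> (\<lambda>x. f x + g x) \<in> R"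
    and uminus_mem: "f \<in> R \<Longrightarrow> (\<lambda>x. - f x) \<in> R"
    and mult_mem: "f \<in> R \<Longrightarrow> g \<in> R \<Longrightarrow> (\<lambda>x. f x * g x) \<in> R"
    and cmult_mem: "f \<in> R \<Longrightarrow> (\<lambda>x. c * f x) \<in> R"
    and max_mem: "f \<in> R \<Longrightarrow> g \<in> R \<Longrightarrow> (\<lambda>x. max (f x) (g x)) \<in> R"
    and min_mem: "f \<in> R \<Longrightarrow> g \<in> R \<Longrightarrow> (\<lambda>x. min (f x) (g x)) \<in> R"
    and approx_open: "open A \<Longrightarrow>
      \<exists>f :: nat \<Rightarrow> 'x \<Rightarrow> real. range f \<subseteq> R \<and>
        (\<forall>x. incseq (\<lambda>k. f k x) \<and> (\<lambda>k. f k x) \<longlonglongrightarrow> indicator A x)"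

text \<open>The underlying normed space is the whole type \<open>'v\<close>. Compatibility of the two scalar actions,
  \<open>smul (\<lambda>_. c) v = c *\<^sub>R v\<close>, is not assumed: it follows from the module laws and the norm
  inequality, because additive continuous maps are real-linear.\<close>

locale normed_function_module = approximating_subring R
  for R :: "('x::topological_space \<Rightarrow> real) set" +
  fixes smul :: "('x \<Rightarrow> real) \<Rightarrow> 'v::real_normed_vector \<Rightarrow> 'v"
  assumes smul_one: "smul (\<lambda>_. 1) v = v"
    and smul_smul: "f \<in> R \<Longrightarrow> g \<in> R \<Longrightarrow> smul (\<lambda>x. f x * g x) v = smul f (smul g v)"
    and smul_add_left: "f \<in> R \<Longrightarrow> g \<in> R \<Longrightarrow> smul (\<lambda>x. f x + g x) v = smul f v + smul g v"
    and smul_add_right: "f \<in> R \<Longrightarrow> smul f (v + w) = smul f v + smul f w"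
    and norm_sum_smul_le:
      "\<And>(n::nat) (f :: nat \<Rightarrow> 'x \<Rightarrow> real) (v :: nat \<Rightarrow> 'v).
        n \<ge> 1 \<Longrightarrow> (\<And>i. i \<in> {1..n} \<Longrightarrow> f i \<in> R) \<Longrightarrow>
        disjoint_family_on (\<lambda>i. fsupp (f i)) {1..n} \<Longrightarrow>
        norm (\<Sum>i=1..n. smul (f i) (v i))
          \<le> (MAX i\<in>{1..n}. sup_norm (f i)) * (MAX i\<in>{1..n}. norm (v i))"

definition local_norm ::
  "('x::topological_space \<Rightarrow> real) set \<Rightarrow> (('x \<Rightarrow> real) \<Rightarrow> 'v \<Rightarrow> 'v) \<Rightarrow> 'x set
    \<Rightarrow> 'v::real_normed_vector \<Rightarrow> real"
  where "local_norm R smul A v =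
    Sup {norm (smul f v) | f. f \<in> R \<and> fsupp f \<subseteq> A \<and> sup_norm f \<le> 1}"

definition supported_in ::
  "('x::topological_space \<Rightarrow> real) set \<Rightarrow> (('x \<Rightarrow> real) \<Rightarrow> 'v \<Rightarrow> 'v) \<Rightarrow> 'v::real_normed_vector
    \<Rightarrow> 'x set \<Rightarrow> bool"
  where "supported_in R smul v B \<longleftrightarrow>
    (\<exists>C. closed C \<and> C \<subseteq> B \<and> local_norm R smul (- C) v = 0)"

text \<open>The dual space is \<open>'v \<Rightarrow>\<^sub>L real\<close> with the operator norm. A map whose domain is the Borel
  sigma-algebra is represented by a function extensional on \<open>sets borel\<close>, so that equality of such
  functions is equality of the maps.\<close>

definition dual_valued_measure ::
  "('x::topological_space set \<Rightarrow> 'v::real_normed_vector \<Rightarrow>\<^sub>L real) \<Rightarrow> bool"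
  where "dual_valued_measure N \<longleftrightarrow>
    N \<in> extensional (sets borel) \<and>
    (\<forall>A :: nat \<Rightarrow> 'x set. range A \<subseteq> sets borel \<and> disjoint_family A \<longrightarrow>
      (\<lambda>n. N (A n)) sums N (\<Union>n. A n))"

definition local_vector_measure ::
  "('x::topological_space \<Rightarrow> real) set \<Rightarrow> (('x \<Rightarrow> real) \<Rightarrow> 'v \<Rightarrow> 'v)
    \<Rightarrow> ('x set \<Rightarrow> 'v::real_normed_vector \<Rightarrow>\<^sub>L real) \<Rightarrow> bool"
  where "local_vector_measure R smul N \<longleftrightarrow>
    dual_valued_measure N \<and>
    (\<forall>A v. open A \<and> local_norm R smul A v = 0 \<longrightarrow> blinfun_apply (N A) v = 0)"

definition total_variation ::
  "('x::topological_space set \<Rightarrow> 'v::real_normed_vector \<Rightarrow>\<^sub>L real) \<Rightarrow> 'x set \<Rightarrow> ennreal"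
  where "total_variation N E =
    (SUP \<pi> \<in> {\<pi>. finite \<pi> \<and> \<pi> \<subseteq> sets borel \<and> partition_on E \<pi>}.
      ennreal (\<Sum>A\<in>\<pi>. norm (N A)))"

definition tight ::
  "('x \<Rightarrow> real) set \<Rightarrow> (('x \<Rightarrow> real) \<Rightarrow> 'v \<Rightarrow> 'v) \<Rightarrow> ('v::real_normed_vector \<Rightarrow>\<^sub>L real) \<Rightarrow> bool"
  where "tight R smul F \<longleftrightarrow>
    (\<forall>v (\<phi> :: nat \<Rightarrow> 'x \<Rightarrow> real).
      range \<phi> \<subseteq> R \<and> (\<forall>x. decseq (\<lambda>n. \<phi> n x) \<and> (\<lambda>n. \<phi> n x) \<longlonglongrightarrow> 0) \<longrightarrow>
      (\<lambda>n. blinfun_apply F (smul (\<phi> n) v)) \<longlonglongrightarrow> 0)"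

definition is_functional_measure ::
  "('x::topological_space \<Rightarrow> real) set \<Rightarrow> (('x \<Rightarrow> real) \<Rightarrow> 'v \<Rightarrow> 'v)
    \<Rightarrow> ('v::real_normed_vector \<Rightarrow>\<^sub>L real) \<Rightarrow> 'x measure \<Rightarrow> bool"
  where "is_functional_measure R smul F \<mu> \<longleftrightarrow>
    sets \<mu> = sets borel \<and> finite_measure \<mu> \<and>
    (\<forall>A. open A \<longrightarrow>
      emeasure \<mu> A = ennreal (Sup {blinfun_apply F v | v. norm v \<le> 1 \<and> supported_in R smul v A}))"

end

theory Submission
  imports Defs
begin

text \<open>
  Write \<open>f F\<close> for the functional \<open>v \<mapsto> F (f v)\<close>. On open sets, put \<open>\<rho> A = sup \<parallel>f F\<parallel>\<close> over the \<open>f \<in> R\<close>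
  with \<open>supp f \<subseteq> A\<close> and \<open>\<bar>f\<bar> \<le> 1\<close>. Tightness makes \<open>\<rho>\<close> countably subadditive and equal to the set
  function of the statement; the norm inequality of the module makes it superadditive on disjoint
  supports, so Caratheodory's construction extends it to a finite Borel measure \<open>\<mu>\<close>. Cutting \<open>f\<close>
  into thin horizontal slices gives \<open>\<parallel>f F\<parallel> \<le> \<integral>\<bar>f\<bar> d\<mu>\<close>, and since \<open>R\<close> approximates every indicator
  function in \<open>L\<^sup>1(\<mu>)\<close>, the map \<open>f \<mapsto> f F\<close> extends to indicators: this is \<open>N\<close>, with
  \<open>\<parallel>N A\<parallel> \<le> \<mu> A\<close>. Comparing the total masses \<open>\<parallel>N X\<parallel> = \<parallel>F\<parallel> = \<mu> X\<close> upgrades this to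
  \<open>\<parallel>N A\<parallel> = \<mu> A\<close> for every Borel set \<open>A\<close>, whence \<open>\<bar>N\<bar> = \<mu>\<close>. Conversely, weak locality forces
  \<open>N A v = lim F (p\<^sub>k v)\<close> for open \<open>A\<close>, where the \<open>p\<^sub>k \<in> R\<close> are supported in \<open>A\<close> and equal to \<open>1\<close> on
  open sets increasing to \<open>A\<close>.
\<close>

subsection \<open>Bounded additive maps, and measures from set functions on open sets\<close>

text \<open>Additivity gives integer homogeneity. Hence \<open>n\<close> times the defect at
  \<open>c\<close> is the defect at the fractional part of \<open>n * c\<close>, which is bounded
  independently of \<open>n\<close>; by the Archimedean property the defect vanishes.\<close>

lemma additive_bounded_scaleR:
  fixes g :: "'a::real_normed_vector \<Rightarrow> 'b::real_normed_vector"
  assumes add: "\<And>v w. g (v + w) = g v + g w" and bound: "\<And>v. norm (g v) \<le> K * norm v"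
  shows "g (c *\<^sub>R v) = c *\<^sub>R g v"
proof -
  interpret additive g by standard (rule add)
  have nat: "g (of_nat n *\<^sub>R w) = of_nat n *\<^sub>R g w" for n w
    by (induction n) (simp_all add: zero add scaleR_add_left)
  have int: "g (of_int m *\<^sub>R w) = of_int m *\<^sub>R g w" for m w
    by (cases m rule: int_cases2) (simp_all add: nat minus)
  define D where "D = norm (g (c *\<^sub>R v) - c *\<^sub>R g v)"
  have "K * norm v \<ge> 0"
    using bound[of v] norm_ge_zero[of "g v"] by linarith
  have "real n * D \<le> K * norm v + norm (g v)" for n
  proof -
    define m where "m = \<lfloor>of_nat n * c\<rfloor>"
    define r where "r = of_nat n * c - of_int m"
    have r: "0 \<le> r" "r \<le> 1" by (auto simp: r_def m_def) linarith
    have "of_nat n *\<^sub>R (g (c *\<^sub>R v) - c *\<^sub>R g v) = g (of_nat n *\<^sub>R c *\<^sub>R v) - (of_int m + r) *\<^sub>R g v"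
      by (simp add: r_def scaleR_diff_right nat[of n "c *\<^sub>R v", simplified scaleR_scaleR])
    also have "of_nat n *\<^sub>R c *\<^sub>R v = of_int m *\<^sub>R v + r *\<^sub>R v"
      by (simp add: r_def flip: scaleR_add_left)
    finally have "of_nat n *\<^sub>R (g (c *\<^sub>R v) - c *\<^sub>R g v) = g (r *\<^sub>R v) - r *\<^sub>R g v"
      by (simp add: add int scaleR_add_left)
    then have "real n * D = norm (g (r *\<^sub>R v) - r *\<^sub>R g v)"
      unfolding D_def by (metis abs_of_nat norm_scaleR)
    also have "\<dots> \<le> norm (g (r *\<^sub>R v)) + norm (r *\<^sub>R g v)" by (rule norm_triangle_ineq4)
    also have "norm (g (r *\<^sub>R v)) \<le> K * (r * norm v)" using bound[of "r *\<^sub>R v"] r by simp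
    also have "K * (r * norm v) \<le> K * norm v"
      using mult_right_mono[OF r(2) \<open>K * norm v \<ge> 0\<close>] by (simp add: ac_simps)
    also have "norm (r *\<^sub>R g v) \<le> norm (g v)" using r by (simp add: mult_left_le_one_le)
    finally show ?thesis by simp
  qed
  then have "D \<le> 0"
    by (metis linorder_not_le norm_ge_zero ex_less_of_nat_mult)
  then show ?thesis by (simp add: D_def)
qed

text \<open>A one-sided bound suffices because the unit ball is symmetric.\<close>

lemma norm_blinfun_leI:
  fixes F :: "'v::real_normed_vector \<Rightarrow>\<^sub>L real"
  assumes "\<And>v. norm v \<le> 1 \<Longrightarrow> blinfun_apply F v \<le> c"
  shows "norm F \<le> c"
proof (rule norm_blinfun_bound)
  show "0 \<le> c" using assms[of 0] by simp
  fix v :: 'v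
  have *: "blinfun_apply F v \<le> c * norm v" for v :: 'v
  proof (cases "v = 0")
    case False
    then show ?thesis
      using assms[of "inverse (norm v) *\<^sub>R v"]
      by (simp add: blinfun.scaleR_right divide_simps split: if_splits)
  qed simp
  show "norm (blinfun_apply F v) \<le> c * norm v"
    using *[of v] *[of "- v"] by (simp add: blinfun.minus_right abs_le_iff)
qed

lemma blinfun_apply_le_norm:
  fixes F :: "'v::real_normed_vector \<Rightarrow>\<^sub>L real"
  assumes "norm v \<le> 1"
  shows "blinfun_apply F v \<le> norm F"
proof -
  have "\<bar>blinfun_apply F v\<bar> \<le> norm F * norm v" using norm_blinfun[of F v] by simp
  also have "\<dots> \<le> norm F" using assms by (simp add: mult_left_le)
  finally show ?thesis by simp
qed

text \<open>The outer measure takes infima over open supersets. Hypothesis \<open>superadd\<close>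
  is the Caratheodory condition of an open \<open>U\<close> tested on open \<open>E\<close>, with
  \<open>c\<close> approximating the mass of \<open>E \<inter> U\<close> from below and
  \<open>W\<close> an open superset of \<open>E - U\<close>. Testing on open sets is enough, since
  every set is approximated from outside by them.\<close>

lemma measure_from_open_sets:
  fixes \<rho> :: "'a::topological_space set \<Rightarrow> ennreal"
  assumes empty: "\<rho> {} = 0"
    and mono: "\<And>A B. open A \<Longrightarrow> open B \<Longrightarrow> A \<subseteq> B \<Longrightarrow> \<rho> A \<le> \<rho> B"
    and subadd: "\<And>A :: nat \<Rightarrow> 'a set. (\<And>n. open (A n)) \<Longrightarrow> \<rho> (\<Union>n. A n) \<le> (\<Sum>n. \<rho> (A n))"
    and superadd: "\<And>E U c. open E \<Longrightarrow> open U \<Longrightarrow> c < \<rho> (E \<inter> U) \<Longrightarrow>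
      \<exists>W. open W \<and> E - U \<subseteq> W \<and> c + \<rho> W \<le> \<rho> E"
  shows "\<exists>\<mu>. sets \<mu> = sets borel \<and> (\<forall>A. open A \<longrightarrow> emeasure \<mu> A = \<rho> A)"
proof -
  define \<theta> where "\<theta> E = (INF U\<in>{U. open U \<and> E \<subseteq> U}. \<rho> U)" for E
  have \<theta>_le: "\<theta> E \<le> \<rho> U" if "open U" "E \<subseteq> U" for E U
    unfolding \<theta>_def by (rule INF_lower) (use that in auto)
  have \<theta>_open: "\<theta> U = \<rho> U" if "open U" for U
    using that by (intro antisym \<theta>_le) (auto simp: \<theta>_def intro!: INF_greatest mono)
  have \<theta>_mono: "\<theta> A \<le> \<theta> B" if "A \<subseteq> B" for A B
    unfolding \<theta>_def by (rule INF_superset_mono) (use that in auto)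
  have \<theta>_subadd: "\<theta> (\<Union>n. A n) \<le> (\<Sum>n. \<theta> (A n))" for A :: "nat \<Rightarrow> 'a set"
  proof (rule ennreal_le_epsilon)
    fix e :: real assume e: "0 < e" and fin: "(\<Sum>n. \<theta> (A n)) < top"
    have "\<exists>U. open U \<and> A n \<subseteq> U \<and> \<rho> U \<le> \<theta> (A n) + e * (1/2) ^ Suc n" for n
    proof -
      have "\<theta> (A n) < top" using fin by (auto simp: less_top dest!: ennreal_suminf_lessD)
      then have "\<theta> (A n) < \<theta> (A n) + e * (1/2) ^ Suc n" using e by (auto simp: less_top)
      then obtain U where "open U" "A n \<subseteq> U" "\<rho> U < \<theta> (A n) + e * (1/2) ^ Suc n"
        unfolding \<theta>_def[of "A n"] INF_less_iff by auto
      then show ?thesis by (auto intro: less_imp_le)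
    qed
    then obtain U where U: "\<And>n. open (U n)" "\<And>n. A n \<subseteq> U n"
      "\<And>n. \<rho> (U n) \<le> \<theta> (A n) + e * (1/2) ^ Suc n"
      by metis
    have "\<theta> (\<Union>n. A n) \<le> \<rho> (\<Union>n. U n)" using U by (intro \<theta>_le open_UN) auto
    also have "\<dots> \<le> (\<Sum>n. \<rho> (U n))" by (rule subadd) (rule U)
    also have "\<dots> \<le> (\<Sum>n. \<theta> (A n) + e * (1/2) ^ Suc n)" by (intro suminf_le U) auto
    also have "\<dots> = (\<Sum>n. \<theta> (A n)) + (\<Sum>n. ennreal e * ennreal ((1/2) ^ Suc n))"
      using e by (subst suminf_add[symmetric])
        (auto simp del: ennreal_suminf_cmult simp add: ennreal_mult[symmetric])
    also have "\<dots> = (\<Sum>n. \<theta> (A n)) + e"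
      unfolding ennreal_suminf_cmult
      by (subst suminf_ennreal_eq[OF zero_le_power power_half_series]) auto
    finally show "\<theta> (\<Union>n. A n) \<le> (\<Sum>n. \<theta> (A n)) + e" .
  qed
  have oms: "outer_measure_space (Pow UNIV) \<theta>"
    by (auto simp: outer_measure_space_def positive_def increasing_def countably_subadditive_def
        \<theta>_open empty intro: \<theta>_mono \<theta>_subadd)
  define L where "L = lambda_system UNIV (Pow UNIV) \<theta>"
  have ms: "measure_space UNIV L \<theta>"
    unfolding L_def by (rule sigma_algebra.caratheodory_lemma[OF sigma_algebra_Pow oms])
  have subadditive: "\<theta> (A \<union> B) \<le> \<theta> A + \<theta> B" if "A \<inter> B = {}" for A B
    using that oms ring_of_sets_Pow[of UNIV]
      ring_of_sets.countably_subadditive_subadditive[of UNIV "Pow UNIV" \<theta>]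
      subadditiveD[of "Pow UNIV" \<theta>]
    by (auto simp: outer_measure_space_def)
  have "open U \<Longrightarrow> U \<in> L" for U
    unfolding L_def algebra.lambda_system_eq[OF algebra_Pow]
  proof (intro CollectI conjI ballI antisym)
    fix E assume U: "open U"
    show "\<theta> E \<le> \<theta> (E \<inter> U) + \<theta> (E - U)"
      using subadditive[of "E \<inter> U" "E - U"] by (simp add: Int_Diff_Un Int_Diff_disjoint)
    show "\<theta> (E \<inter> U) + \<theta> (E - U) \<le> \<theta> E"
      unfolding \<theta>_def[of E]
    proof (safe intro!: INF_greatest)
      fix V assume V: "open V" "E \<subseteq> V"
      have "\<theta> (E \<inter> U) + \<theta> (E - U) \<le> \<rho> (V \<inter> U) + \<theta> (V - U)"
        using U V by (intro add_mono \<theta>_le \<theta>_mono) auto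
      also have "\<dots> \<le> \<rho> V"
      \<comment> \<open>Mass zero is treated apart: no \<open>c\<close> lies strictly below it, and
        addition commutes with the supremum over \<open>c\<close> only for a nonempty index
        set.\<close>
      proof (cases "\<rho> (V \<inter> U) = 0")
        case True
        then show ?thesis using \<theta>_le[of V "V - U"] V by auto
      next
        case False
        have *: "c + \<theta> (V - U) \<le> \<rho> V" if c: "c < \<rho> (V \<inter> U)" for c
        proof -
          obtain W where "open W" "V - U \<subseteq> W" "c + \<rho> W \<le> \<rho> V"
            using superadd[OF V(1) U c] by auto
          then show ?thesis using \<theta>_le[of W "V - U"] by (meson add_left_mono order_trans)
        qed
        have ne: "{..<\<rho> (V \<inter> U)} \<noteq> {}" using False by (auto simp: lessThan_def zero_less_iff_neq_zero intro!: exI[of _ 0])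
        have "\<rho> (V \<inter> U) = (SUP c\<in>{..<\<rho> (V \<inter> U)}. c)"
          using False by (simp add: Sup_lessThan zero_less_iff_neq_zero)
        then have "\<rho> (V \<inter> U) + \<theta> (V - U) = (SUP c\<in>{..<\<rho> (V \<inter> U)}. c + \<theta> (V - U))"
          using ennreal_SUP_add_left[OF ne, where c = "\<theta> (V - U)" and f = "\<lambda>c. c"] by simp
        also have "\<dots> \<le> \<rho> V" by (rule SUP_least) (use * in auto)
        finally show ?thesis .
      qed
      finally show "\<theta> (E \<inter> U) + \<theta> (E - U) \<le> \<rho> V" .
    qed
  qed auto
  moreover have "sigma_algebra UNIV L" using ms by (simp add: measure_space_def)
  ultimately have sub: "sets borel \<subseteq> L"
    using sigma_algebra.sigma_sets_subset[of UNIV L "Collect open"] by (auto simp: borel_def)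
  have "measure_space UNIV (sets borel) \<theta>"
    using ms sub sets.sigma_algebra_axioms[of "borel :: 'a measure"]
    unfolding measure_space_def positive_def countably_additive_def by (auto simp: subset_iff)
  then have "emeasure (measure_of UNIV (sets borel) \<theta>) A = \<theta> A" if "A \<in> sets borel" for A
    using that sets.sigma_algebra_axioms[of "borel :: 'a measure"]
    by (intro emeasure_measure_of_sigma) (auto simp: measure_space_def)
  then show ?thesis
    by (intro exI[of _ "measure_of UNIV (sets borel) \<theta>"])
      (auto simp: \<theta>_open sets.sigma_sets_eq[of "borel :: 'a measure", simplified])
qed

subsection \<open>Normed modules over function rings\<close>

lemma fsupp_subsetI: "closed C \<Longrightarrow> (\<And>x. x \<notin> C \<Longrightarrow> f x = 0) \<Longrightarrow> fsupp f \<subseteq> C"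
  unfolding fsupp_def by (rule closure_minimal) auto

lemma zero_outside_fsupp: "x \<notin> fsupp f \<Longrightarrow> f x = 0"
  unfolding fsupp_def using closure_subset[of "{x. f x \<noteq> 0}"] by auto

lemma closed_fsupp: "closed (fsupp f)"
  by (simp add: fsupp_def)

lemma sup_norm_leI: "(\<And>x. \<bar>f x\<bar> \<le> c) \<Longrightarrow> sup_norm f \<le> c"
  unfolding sup_norm_def by (rule cSUP_least) auto

section \<open>Approximation of open sets with supports inside\<close>

context approximating_subring
begin

lemma continuous_mem: "f \<in> R \<Longrightarrow> continuous_on UNIV f"
  using subset_Cb by (auto simp: bcontfun_def)

lemma abs_le_sup_norm: "f \<in> R \<Longrightarrow> \<bar>f x\<bar> \<le> sup_norm f"
  unfolding sup_norm_def
proof (rule cSUP_upper)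
  assume "f \<in> R"
  then have "bounded (range f)" using subset_Cb by (auto simp: bcontfun_def)
  then show "bdd_above (range (\<lambda>x. \<bar>f x\<bar>))"
    by (auto simp: bounded_iff bdd_above_def)
qed simp

lemma const_mem: "(\<lambda>_. c) \<in> R"
  using cmult_mem[OF one_mem, of c] by simp

lemma diff_mem: "f \<in> R \<Longrightarrow> g \<in> R \<Longrightarrow> (\<lambda>x. f x - g x) \<in> R"
  using add_mem[OF _ uminus_mem, of f g] by simp

lemma sum_mem: "(\<And>i. i \<in> I \<Longrightarrow> f i \<in> R) \<Longrightarrow> (\<lambda>x. \<Sum>i\<in>I. f i x) \<in> R"
  by (induction I rule: infinite_finite_induct) (auto intro: const_mem add_mem)

text \<open>A sequence given by \<open>approx_open\<close> may have supports that leave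
  \<open>A\<close>. Subtracting 1/(k+1) and truncating at 0 confines the support of the k-th
  function to a closed set on which the original is at least 1/(k+1), hence to \<open>A\<close>;
  monotonicity and the limit survive.\<close>

lemma open_approximation:
  assumes "open A"
  obtains f :: "nat \<Rightarrow> 'x \<Rightarrow> real"
  where "\<And>k. f k \<in> R" "\<And>k. fsupp (f k) \<subseteq> A" "\<And>k x. 0 \<le> f k x" "\<And>k x. f k x \<le> 1"
    "\<And>x. incseq (\<lambda>k. f k x)" "\<And>x. (\<lambda>k. f k x) \<longlonglongrightarrow> indicator A x"
proof -
  obtain g :: "nat \<Rightarrow> 'x \<Rightarrow> real" where g: "\<And>k. g k \<in> R" "\<And>x. incseq (\<lambda>k. g k x)"
    "\<And>x. (\<lambda>k. g k x) \<longlonglongrightarrow> indicator A x"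
    using approx_open[OF assms] by (auto simp: image_subset_iff)
  have g_le: "g k x \<le> indicator A x" for k x
    by (rule incseq_le[OF g(2,3)])
  define f where "f = (\<lambda>k x. max 0 (g k x - inverse (real (Suc k))))"
  show ?thesis
  proof (rule that[of f])
    show "f k \<in> R" for k
      using max_mem[OF const_mem[of 0] diff_mem[OF g(1)[of k] const_mem[of "inverse (real (Suc k))"]]] by (simp only: f_def)
    show "fsupp (f k) \<subseteq> A" for k
    proof -
      have "fsupp (f k) \<subseteq> {x. inverse (real (Suc k)) \<le> g k x}"
        by (rule fsupp_subsetI) (auto intro!: closed_Collect_le continuous_on_const continuous_mem[OF g(1)] simp: f_def)
      also have "\<dots> \<subseteq> A"
      proof safe
        fix x assume "inverse (real (Suc k)) \<le> g k x"
        then have "0 < g k x" by (rule less_le_trans[rotated]) simp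
        then show "x \<in> A" using g_le[of k x] by (cases "x \<in> A") auto
      qed
      finally show ?thesis .
    qed
    show "0 \<le> f k x" for k x by (simp add: f_def)
    show "f k x \<le> 1" for k x
    proof -
      have "g k x \<le> 1" using g_le[of k x] by (cases "x \<in> A") auto
      moreover have "0 \<le> inverse (real (Suc k))" by simp
      ultimately show ?thesis unfolding f_def by linarith
    qed
    show "incseq (\<lambda>k. f k x)" for x
      unfolding f_def
    proof (intro monoI max.mono diff_mono order_refl)
      fix m n :: nat assume "m \<le> n"
      then show "g m x \<le> g n x" using g(2)[of x] by (simp add: incseq_def)
      show "inverse (real (Suc n)) \<le> inverse (real (Suc m))" using \<open>m \<le> n\<close> by (simp add: le_imp_inverse_le)
    qed
    show "(\<lambda>k. f k x) \<longlonglongrightarrow> indicator A x" for x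
    proof -
      have "(\<lambda>k. f k x) \<longlonglongrightarrow> max 0 (indicator A x - 0)"
        unfolding f_def by (intro tendsto_intros g LIMSEQ_inverse_real_of_nat)
      then show ?thesis by (simp add: max_absorb2)
    qed
  qed
qed

end

section \<open>Module inequalities, local norms and multiplied functionals\<close>

context normed_function_module
begin

lemma norm_smul_le: "f \<in> R \<Longrightarrow> norm (smul f v) \<le> sup_norm f * norm v"
  using norm_sum_smul_le[of 1 "\<lambda>_. f" "\<lambda>_. v"] by (simp add: disjoint_family_on_def)

lemma norm_smul_le': "f \<in> R \<Longrightarrow> (\<And>x. \<bar>f x\<bar> \<le> c) \<Longrightarrow> norm (smul f v) \<le> c * norm v"
  by (meson norm_smul_le sup_norm_leI mult_right_mono norm_ge_zero order_trans)

text \<open>The two-term case of the module inequality; superadditivity of the mass on disjoint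
  supports rests on it.\<close>

lemma norm_add_smul_le_one:
  assumes "f \<in> R" "g \<in> R" "fsupp f \<inter> fsupp g = {}" "\<And>x. \<bar>f x\<bar> \<le> 1" "\<And>x. \<bar>g x\<bar> \<le> 1"
    "norm v \<le> 1" "norm w \<le> 1"
  shows "norm (smul f v + smul g w) \<le> 1"
proof -
  define h where "h i = (if i = 1 then f else g)" for i :: nat
  define u where "u i = (if i = 1 then v else w)" for i :: nat
  have I: "{1..2} = {1, 2 :: nat}" by auto
  have "norm (\<Sum>i=1..2. smul (h i) (u i)) \<le> (MAX i\<in>{1..2}. sup_norm (h i)) * (MAX i\<in>{1..2}. norm (u i))"
    using assms by (intro norm_sum_smul_le) (auto simp: h_def disjoint_family_on_def I)
  also have "\<dots> \<le> 1 * 1"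
  proof (rule mult_mono)
    show "(MAX i\<in>{1..2}. sup_norm (h i)) \<le> 1" "(MAX i\<in>{1..2}. norm (u i)) \<le> 1"
      using assms by (auto simp: I h_def u_def intro: sup_norm_leI)
    show "0 \<le> (MAX i\<in>{1..2}. norm (u i))"
      unfolding I by (simp add: le_max_iff_disj)
  qed simp
  also have "(\<Sum>i=1..2. smul (h i) (u i)) = smul f v + smul g w"
    unfolding I by (simp add: h_def u_def)
  finally show ?thesis by simp
qed

lemma smul_bounded_linear: "f \<in> R \<Longrightarrow> bounded_linear (smul f)"
proof (rule bounded_linear_intro)
  assume f: "f \<in> R"
  show "norm (smul f v) \<le> norm v * sup_norm f" for v
    using norm_smul_le[OF f, of v] by (simp add: mult.commute)
  show "smul f (c *\<^sub>R v) = c *\<^sub>R smul f v" for c v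
    by (rule additive_bounded_scaleR) (use f in \<open>auto intro: smul_add_right norm_smul_le\<close>)
qed (rule smul_add_right)

lemma smul_zero_left: "smul (\<lambda>_. 0) v = 0"
  using smul_add_left[OF const_mem[of 0] const_mem[of 0], of v] by simp

lemma smul_smul_eq_zero:
  assumes "f \<in> R" "g \<in> R" "\<And>x. f x = 0 \<or> g x = 0"
  shows "smul f (smul g v) = 0"
proof -
  have "(\<lambda>x. f x * g x) = (\<lambda>_. 0)" using assms(3) by fastforce
  then show ?thesis using smul_smul[OF assms(1,2), of v] by (simp add: smul_zero_left)
qed

lemma smul_eq_zero_of_local_norm:
  assumes "local_norm R smul A v = 0" "f \<in> R" "fsupp f \<subseteq> A" "\<And>x. \<bar>f x\<bar> \<le> 1"
  shows "smul f v = 0"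
proof -
  have "norm (smul f v) \<le> local_norm R smul A v"
    unfolding local_norm_def
  proof (rule cSup_upper)
    show "norm (smul f v) \<in> {norm (smul f v) |f. f \<in> R \<and> fsupp f \<subseteq> A \<and> sup_norm f \<le> 1}"
      using assms by (auto intro: sup_norm_leI)
    \<comment> \<open>The real-valued \<open>Sup\<close> is an upper bound only of a set that is
      bounded above; here \<open>norm v\<close> bounds it.\<close>
    have "norm (smul g v) \<le> norm v" if "g \<in> R" "sup_norm g \<le> 1" for g
      using norm_smul_le[OF that(1), of v] that(2) mult_right_mono[OF that(2), of "norm v"] by simp
    then show "bdd_above {norm (smul f v) |f. f \<in> R \<and> fsupp f \<subseteq> A \<and> sup_norm f \<le> 1}"
      by (auto simp: bdd_above_def)
  qed
  then show ?thesis using assms(1) by simp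
qed

lemma local_norm_eq_zeroI:
  assumes "\<And>f. f \<in> R \<Longrightarrow> fsupp f \<subseteq> A \<Longrightarrow> smul f v = 0"
  shows "local_norm R smul A v = 0"
proof -
  \<comment> \<open>The zero function is always admissible, so the supremum is taken over the
    singleton of 0 and not over the empty set.\<close>
  have "(\<lambda>_. 0) \<in> R" "fsupp (\<lambda>_::'x. 0 :: real) \<subseteq> A" "sup_norm (\<lambda>_::'x. 0 :: real) \<le> 1"
    by (auto intro!: const_mem sup_norm_leI simp: fsupp_def)
  then have "{norm (smul f v) |f. f \<in> R \<and> fsupp f \<subseteq> A \<and> sup_norm f \<le> 1} = {0}"
    using assms by (auto intro!: exI[of _ "\<lambda>_. 0"])
  then show ?thesis by (simp add: local_norm_def)
qed

text \<open>A multiplier supported in \<open>A\<close> vanishes wherever \<open>f\<close> does not,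
  so its product with \<open>f\<close> is zero. In this form weak locality is applied to vectors
  \<open>smul f v\<close>.\<close>

lemma local_norm_smul_eq_zero:
  assumes "f \<in> R" "A \<inter> fsupp f = {}"
  shows "local_norm R smul A (smul f v) = 0"
  by (rule local_norm_eq_zeroI, rule smul_smul_eq_zero)
    (use assms zero_outside_fsupp in blast)+

text \<open>The functional \<open>f F\<close> of the overview. \<open>Blinfun (smul f)\<close> is
  meaningful only for \<open>f\<close> in \<open>R\<close>, where \<open>smul f\<close> is known to
  be bounded and linear.\<close>

definition multiplied :: "('v \<Rightarrow>\<^sub>L real) \<Rightarrow> ('x \<Rightarrow> real) \<Rightarrow> 'v \<Rightarrow>\<^sub>L real"
  where "multiplied F f = F o\<^sub>L Blinfun (smul f)"

lemma multiplied_apply: "f \<in> R \<Longrightarrow> blinfun_apply (multiplied F f) v = blinfun_apply F (smul f v)"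
  by (simp add: multiplied_def bounded_linear_Blinfun_apply smul_bounded_linear)

lemma multiplied_add:
  "f \<in> R \<Longrightarrow> g \<in> R \<Longrightarrow> multiplied F (\<lambda>x. f x + g x) = multiplied F f + multiplied F g"
  by (rule blinfun_eqI)
    (simp add: multiplied_apply add_mem smul_add_left blinfun.add_left blinfun.add_right)

lemma multiplied_one: "multiplied F (\<lambda>_. 1) = F"
  by (rule blinfun_eqI) (simp add: multiplied_apply one_mem smul_one)

lemma multiplied_zero: "multiplied F (\<lambda>_. 0) = 0"
  by (rule blinfun_eqI) (simp add: multiplied_apply const_mem smul_zero_left)

lemma multiplied_diff:
  assumes "f \<in> R" "g \<in> R"
  shows "multiplied F (\<lambda>x. f x - g x) = multiplied F f - multiplied F g"
  using multiplied_add[OF diff_mem[OF assms] assms(2)] by simp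

lemma multiplied_sum:
  "(\<And>i. i \<in> I \<Longrightarrow> f i \<in> R) \<Longrightarrow> multiplied F (\<lambda>x. \<Sum>i\<in>I. f i x) = (\<Sum>i\<in>I. multiplied F (f i))"
  by (induction I rule: infinite_finite_induct) (auto simp: multiplied_zero multiplied_add sum_mem)

lemma norm_multiplied_le:
  assumes f: "f \<in> R" and "\<And>x. \<bar>f x\<bar> \<le> 1"
  shows "norm (multiplied F f) \<le> norm F"
proof (rule norm_blinfun_leI)
  fix v :: 'v assume v: "norm v \<le> 1"
  then have "norm (smul f v) \<le> 1" using norm_smul_le'[OF assms, of v] by simp
  then show "blinfun_apply (multiplied F f) v \<le> norm F"
    by (simp add: multiplied_apply f blinfun_apply_le_norm)
qed

text \<open>The factor \<open>c\<close> is moved onto the vector as a constant function of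
  \<open>R\<close>, which stretches norms by at most \<open>c\<close>. This reduces a slice of
  height \<open>c\<close> to a multiplier bounded by 1.\<close>

lemma norm_multiplied_scale:
  assumes "f \<in> R" "0 < c"
  shows "norm (multiplied F f) \<le> c * norm (multiplied F (\<lambda>x. f x / c))"
proof (rule norm_blinfun_leI)
  fix v :: 'v assume v: "norm v \<le> 1"
  have [simp]: "(\<lambda>x. f x / c) \<in> R" using cmult_mem[OF assms(1), of "1 / c"] by simp
  have "smul f v = smul (\<lambda>x. f x / c) (smul (\<lambda>_. c) v)"
    using assms(2) by (simp flip: smul_smul add: const_mem)
  then have "blinfun_apply (multiplied F f) v = blinfun_apply (multiplied F (\<lambda>x. f x / c)) (smul (\<lambda>_. c) v)"
    using assms by (simp add: multiplied_apply)
  also have "\<dots> \<le> norm (multiplied F (\<lambda>x. f x / c)) * norm (smul (\<lambda>_. c) v)"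
    using norm_blinfun[of "multiplied F (\<lambda>x. f x / c)" "smul (\<lambda>_. c) v"] by simp
  also have "\<dots> \<le> norm (multiplied F (\<lambda>x. f x / c)) * c"
  proof (rule mult_left_mono)
    have "norm (smul (\<lambda>_. c) v) \<le> c * norm v"
      by (rule norm_smul_le'[OF const_mem]) (use assms in simp)
    also have "\<dots> \<le> c" using v assms by simp
    finally show "norm (smul (\<lambda>_. c) v) \<le> c" .
  qed simp
  finally show "blinfun_apply (multiplied F f) v \<le> c * norm (multiplied F (\<lambda>x. f x / c))"
    by (simp add: mult.commute)
qed

end

subsection \<open>The measure of a tight functional\<close>

text \<open>The seed \<open>e\<close> is kept apart from the sequence \<open>h\<close> because it is
  harmless for another reason: it will annihilate the vector, whereas each \<open>h i\<close> costs
  the mass of an open set. At stage \<open>n\<close> only the \<open>h i\<close> with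
  \<open>i < n\<close> have entered.\<close>

primrec max_upto :: "('x \<Rightarrow> real) \<Rightarrow> (nat \<Rightarrow> 'x \<Rightarrow> real) \<Rightarrow> nat \<Rightarrow> 'x \<Rightarrow> real"
  where "max_upto e h 0 = e"
  | "max_upto e h (Suc n) = (\<lambda>x. max (max_upto e h n x) (h n x))"

lemma max_upto_le: "e x \<le> c \<Longrightarrow> (\<And>i. h i x \<le> c) \<Longrightarrow> max_upto e h n x \<le> c"
  by (induction n) auto

lemma le_max_upto: "e x \<le> max_upto e h n x"
  by (induction n) auto

lemma nth_le_max_upto: "i < n \<Longrightarrow> h i x \<le> max_upto e h n x"
  by (induction n) (auto simp: less_Suc_eq le_max_iff_disj)

lemma max_upto_mono:
  assumes "e x \<le> e' x" "\<And>i. h i x \<le> h' i x" "m \<le> n"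
  shows "max_upto e h m x \<le> max_upto e' h' n x"
proof -
  have "max_upto e h m x \<le> max_upto e' h' m x"
    by (induction m) (use assms in \<open>simp_all add: max.coboundedI1 max.coboundedI2\<close>)
  also have "\<dots> \<le> max_upto e' h' n x"
    using \<open>m \<le> n\<close> by (induction rule: dec_induct) auto
  finally show ?thesis .
qed

lemma (in approximating_subring) max_upto_mem:
  "e \<in> R \<Longrightarrow> (\<And>i. h i \<in> R) \<Longrightarrow> max_upto e h n \<in> R"
  by (induction n) (simp_all add: max_mem)

locale tight_functional = normed_function_module R smul
  for R :: "('x::topological_space \<Rightarrow> real) set" and smul :: "('x \<Rightarrow> real) \<Rightarrow> 'v::real_normed_vector \<Rightarrow> 'v" +
  fixes F :: "'v \<Rightarrow>\<^sub>L real"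
  assumes tight: "tight R smul F"
begin

abbreviation T :: "('x \<Rightarrow> real) \<Rightarrow> 'v \<Rightarrow>\<^sub>L real"
  where "T \<equiv> multiplied F"

text \<open>Multipliers supported in \<open>A\<close> replace the vectors supported in
  \<open>A\<close> of the theorem; \<open>open_mass_eq_Sup\<close> shows that the two suprema
  agree.\<close>

definition open_mass :: "'x set \<Rightarrow> real"
  where "open_mass A = (SUP f\<in>{f\<in>R. fsupp f \<subseteq> A \<and> (\<forall>x. \<bar>f x\<bar> \<le> 1)}. norm (T f))"

lemma bdd_above_open_mass: "bdd_above ((\<lambda>f. norm (T f)) ` {f\<in>R. fsupp f \<subseteq> A \<and> (\<forall>x. \<bar>f x\<bar> \<le> 1)})"
  by (rule bdd_aboveI2[of _ _ "norm F"]) (auto intro: norm_multiplied_le)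

lemma zero_in_open_mass: "(\<lambda>_. 0) \<in> {f\<in>R. fsupp f \<subseteq> A \<and> (\<forall>x. \<bar>f x\<bar> \<le> 1)}"
  by (auto simp: fsupp_def const_mem)

lemma open_mass_domain_nonempty: "{f\<in>R. fsupp f \<subseteq> A \<and> (\<forall>x. \<bar>f x\<bar> \<le> 1)} \<noteq> {}"
  using zero_in_open_mass by blast

lemma norm_le_open_mass:
  "f \<in> R \<Longrightarrow> fsupp f \<subseteq> A \<Longrightarrow> (\<And>x. \<bar>f x\<bar> \<le> 1) \<Longrightarrow> norm (T f) \<le> open_mass A"
  unfolding open_mass_def by (rule cSUP_upper[OF _ bdd_above_open_mass]) auto

lemma open_mass_leI:
  "(\<And>f. f \<in> R \<Longrightarrow> fsupp f \<subseteq> A \<Longrightarrow> (\<And>x. \<bar>f x\<bar> \<le> 1) \<Longrightarrow> norm (T f) \<le> c) \<Longrightarrow> open_mass A \<le> c"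
  unfolding open_mass_def by (rule cSUP_least[OF open_mass_domain_nonempty]) auto

lemma open_mass_nonneg: "0 \<le> open_mass A"
  using norm_le_open_mass[of "\<lambda>_. 0" A] zero_in_open_mass[of A] by (simp add: multiplied_zero)

lemma open_mass_mono: "A \<subseteq> B \<Longrightarrow> open_mass A \<le> open_mass B"
  by (rule open_mass_leI, rule norm_le_open_mass) auto

lemma open_mass_empty: "open_mass {} = 0"
proof (rule antisym)
  show "open_mass {} \<le> 0"
  proof (rule open_mass_leI)
    fix f :: "'x \<Rightarrow> real" assume "fsupp f \<subseteq> {}"
    then have "f = (\<lambda>_. 0)" by (auto dest: zero_outside_fsupp)
    then show "norm (T f) \<le> 0" by (simp add: multiplied_zero)
  qed
qed (rule open_mass_nonneg)

text \<open>The successive differences of the running maximum are supported in the sets \<open>A i\<close>.\<close>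

lemma abs_apply_max_upto_le:
  assumes "e \<in> R" "\<And>x. 0 \<le> e x" "\<And>x. e x \<le> 1" "smul e v = 0"
    and "\<And>i. h i \<in> R" "\<And>i. fsupp (h i) \<subseteq> A i" "\<And>i x. h i x \<le> 1"
  shows "\<bar>blinfun_apply (T (max_upto e h n)) v\<bar> \<le> (\<Sum>i<n. open_mass (A i)) * norm v"
proof (induction n)
  case 0
  then show ?case using assms by (simp add: multiplied_apply)
next
  case (Suc n)
  define p where "p = (\<lambda>x. max_upto e h (Suc n) x - max_upto e h n x)"
  have mem: "max_upto e h m \<in> R" for m
    using assms by (intro max_upto_mem)
  have bounds: "0 \<le> max_upto e h m x" "max_upto e h m x \<le> 1" for m x
    using order_trans[OF assms(2)[of x] le_max_upto[of e x h m]] assms by (auto intro: max_upto_le)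
  have p: "p \<in> R" unfolding p_def by (intro diff_mem mem)
  have "norm (T p) \<le> open_mass (A n)"
  proof (rule norm_le_open_mass[OF p])
    \<comment> \<open>Off the support of \<open>h n\<close> the new entry is 0, which cannot raise a
      running maximum that is nonnegative thanks to \<open>e\<close>.\<close>
    have "p x = 0" if "x \<notin> fsupp (h n)" for x
      using zero_outside_fsupp[OF that] bounds[of n x] by (simp add: p_def)
    then have "fsupp p \<subseteq> fsupp (h n)" by (intro fsupp_subsetI closed_fsupp)
    then show "fsupp p \<subseteq> A n" using assms(6) by blast
    show "\<bar>p x\<bar> \<le> 1" for x
      using bounds[of n x] bounds[of "Suc n" x] by (auto simp: p_def)
  qed
  then have "\<bar>blinfun_apply (T p) v\<bar> \<le> open_mass (A n) * norm v"
    using norm_blinfun[of "T p" v] by (simp add: mult_right_mono order_trans)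
  moreover have "T (max_upto e h (Suc n)) = T (max_upto e h n) + T p"
    using multiplied_add[OF mem[of n] p] by (simp add: p_def)
  ultimately show ?case
    using Suc.IH by (simp add: blinfun.add_left distrib_right)
qed

text \<open>Approximating \<open>- C\<close> and each \<open>A i\<close> from below, the running maxima increase to \<open>1\<close>, so tightness
  applies to their complements, while the part approximating \<open>- C\<close> annihilates \<open>v\<close>.\<close>

lemma abs_apply_le_of_cover:
  fixes A :: "nat \<Rightarrow> 'x set"
  assumes C: "closed C" "local_norm R smul (- C) v = 0"
    and A: "\<And>i. open (A i)" "C \<subseteq> (\<Union>i. A i)"
    and L: "\<And>n. (\<Sum>i<n. open_mass (A i)) \<le> L"
  shows "\<bar>blinfun_apply F v\<bar> \<le> L * norm v"
proof -
  obtain e where e: "\<And>k. e k \<in> R" "\<And>k. fsupp (e k) \<subseteq> - C" "\<And>k x. 0 \<le> e k x" "\<And>k x. e k x \<le> 1"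
    "\<And>x. incseq (\<lambda>k. e k x)" "\<And>x. (\<lambda>k. e k x) \<longlonglongrightarrow> indicator (- C) x"
    using open_approximation[of "- C"] C by (auto simp: open_Compl)
  have "\<forall>i. \<exists>f :: nat \<Rightarrow> 'x \<Rightarrow> real. (\<forall>k. f k \<in> R) \<and> (\<forall>k. fsupp (f k) \<subseteq> A i) \<and> (\<forall>k x. f k x \<le> 1) \<and>
      (\<forall>x. incseq (\<lambda>k. f k x)) \<and> (\<forall>x. (\<lambda>k. f k x) \<longlonglongrightarrow> indicator (A i) x)"
    by (intro allI, rule open_approximation[OF A(1)]) blast
  then obtain h :: "nat \<Rightarrow> nat \<Rightarrow> 'x \<Rightarrow> real" where h: "\<And>i k. h i k \<in> R" "\<And>i k. fsupp (h i k) \<subseteq> A i"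
    "\<And>i k x. h i k x \<le> 1" "\<And>i x. incseq (\<lambda>k. h i k x)"
    "\<And>i x. (\<lambda>k. h i k x) \<longlonglongrightarrow> indicator (A i) x"
    by metis
  \<comment> \<open>A diagonal choice: \<open>k\<close> is both the accuracy of the approximations
    and the number of sets \<open>A i\<close> that are used.\<close>
  define g where "g k = max_upto (e k) (\<lambda>i. h i k) k" for k
  have g_mem: "g k \<in> R" for k unfolding g_def by (intro max_upto_mem e h)
  have g_le: "g k x \<le> 1" for k x unfolding g_def by (intro max_upto_le e h)
  have g_lim: "(\<lambda>k. g k x) \<longlonglongrightarrow> 1" for x
  proof (cases "x \<in> C")
    case True
    then obtain i where i: "x \<in> A i" using A by auto
    show ?thesis
    proof (rule tendsto_sandwich)
      show "(\<lambda>k. h i k x) \<longlonglongrightarrow> 1" using h(5)[of i x] i by simp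
      show "\<forall>\<^sub>F k in sequentially. h i k x \<le> g k x"
        using eventually_gt_at_top[of i] unfolding g_def
        by eventually_elim (rule nth_le_max_upto)
    qed (use g_le in auto)
  next
    case False
    show ?thesis
    proof (rule tendsto_sandwich)
      show "(\<lambda>k. e k x) \<longlonglongrightarrow> 1" using e(6)[of x] False by simp
      show "\<forall>\<^sub>F k in sequentially. e k x \<le> g k x"
        unfolding g_def by (intro always_eventually allI le_max_upto)
    qed (use g_le in auto)
  qed
  have g_mono: "g m x \<le> g n x" if "m \<le> n" for m n x
    unfolding g_def using e(5) h(4) that by (intro max_upto_mono) (auto simp: incseq_def)
  have lim: "(\<lambda>k. blinfun_apply F (smul (\<lambda>x. 1 - g k x) v)) \<longlonglongrightarrow> 0"
  proof (rule tight[unfolded tight_def, rule_format], safe)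
    show "(\<lambda>x. 1 - g k x) \<in> R" for k by (intro diff_mem g_mem const_mem)
    show "decseq (\<lambda>k. 1 - g k x)" for x using g_mono by (simp add: decseq_def)
    show "(\<lambda>k. 1 - g k x) \<longlonglongrightarrow> 0" for x
      using tendsto_diff[OF tendsto_const g_lim[of x], of 1] by simp
  qed
  have bound: "\<bar>blinfun_apply F v\<bar> - L * norm v \<le> \<bar>blinfun_apply F (smul (\<lambda>x. 1 - g k x) v)\<bar>" for k
  proof -
    have "T (\<lambda>x. 1 - g k x) = F - T (g k)"
      by (simp add: multiplied_diff const_mem g_mem multiplied_one)
    then have "blinfun_apply F (smul (\<lambda>x. 1 - g k x) v) = blinfun_apply F v - blinfun_apply (T (g k)) v"
      using multiplied_apply[OF diff_mem[OF one_mem g_mem[of k]], of F v] by (simp add: blinfun.diff_left)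
    moreover have "\<bar>blinfun_apply (T (g k)) v\<bar> \<le> L * norm v"
    proof -
      have "\<bar>blinfun_apply (T (g k)) v\<bar> \<le> (\<Sum>i<k. open_mass (A i)) * norm v"
        unfolding g_def
      proof (rule abs_apply_max_upto_le[OF e(1,3,4) _ h(1-3)])
        show "smul (e k) v = 0"
          by (rule smul_eq_zero_of_local_norm[OF C(2) e(1,2)]) (simp add: e)
      qed
      also have "\<dots> \<le> L * norm v" by (intro mult_right_mono L) simp
      finally show ?thesis .
    qed
    ultimately show ?thesis by linarith
  qed
  show ?thesis
    using LIMSEQ_le_const[OF tendsto_rabs[OF lim], of "\<bar>blinfun_apply F v\<bar> - L * norm v"] bound by simp
qed

lemma apply_le_open_mass:
  assumes "open A" "supported_in R smul v A" "norm v \<le> 1"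
  shows "blinfun_apply F v \<le> open_mass A"
proof -
  obtain C where C: "closed C" "C \<subseteq> A" "local_norm R smul (- C) v = 0"
    using assms(2) by (auto simp: supported_in_def)
  have "\<bar>blinfun_apply F v\<bar> \<le> open_mass A * norm v"
  \<comment> \<open>The cover consists of \<open>A\<close> alone, padded with empty sets of mass
    0.\<close>
  proof (rule abs_apply_le_of_cover[OF C(1,3), of "\<lambda>i. if i = 0 then A else {}"])
    show "(\<Sum>i<n. open_mass (if i = 0 then A else {})) \<le> open_mass A" for n :: nat
      by (induction n) (auto simp: open_mass_empty open_mass_nonneg lessThan_Suc)
  qed (use assms C in auto)
  also have "\<dots> \<le> open_mass A" using assms(3) by (simp add: mult_left_le open_mass_nonneg)
  finally show ?thesis by simp
qed

lemma supported_in_smul: "f \<in> R \<Longrightarrow> fsupp f \<subseteq> A \<Longrightarrow> supported_in R smul (smul f v) A"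
  unfolding supported_in_def
  by (intro exI[of _ "fsupp f"]) (auto simp: closed_fsupp intro!: local_norm_smul_eq_zero)

text \<open>One inequality holds because \<open>smul f v\<close> is itself a competitor on the
  right. The other one is \<open>apply_le_open_mass\<close>, where tightness enters.\<close>

lemma open_mass_eq_Sup:
  assumes "open A"
  shows "open_mass A = Sup {blinfun_apply F v | v. norm v \<le> 1 \<and> supported_in R smul v A}"
    (is "_ = Sup ?S")
proof (rule antisym)
  have bdd: "bdd_above ?S"
    by (rule bdd_aboveI[of _ "norm F"]) (auto intro: blinfun_apply_le_norm)
  show "open_mass A \<le> Sup ?S"
  proof (intro open_mass_leI norm_blinfun_leI)
    fix f and v :: 'v assume f: "f \<in> R" "fsupp f \<subseteq> A" "\<And>x. \<bar>f x\<bar> \<le> 1" and v: "norm v \<le> 1"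
    have "norm (smul f v) \<le> 1" using norm_smul_le'[OF f(1,3), of v] v by simp
    then have "blinfun_apply F (smul f v) \<in> ?S" using f supported_in_smul by blast
    then show "blinfun_apply (T f) v \<le> Sup ?S"
      unfolding multiplied_apply[OF f(1)] by (rule cSup_upper[OF _ bdd])
  qed
  have "supported_in R smul 0 A"
    using supported_in_smul[of "\<lambda>_. 0" A 0] zero_in_open_mass[of A] by (simp add: smul_zero_left)
  then have "blinfun_apply F 0 \<in> ?S" by (metis (mono_tags, lifting) mem_Collect_eq norm_zero zero_le_one)
  then show "Sup ?S \<le> open_mass A"
    by (intro cSup_least) (auto intro: apply_le_open_mass assms)
qed

text \<open>For \<open>v\<close> and \<open>w\<close> in the unit ball,
  \<open>smul f v + smul g w\<close> again has norm at most 1, by disjointness of the supports, and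
  is supported in \<open>A\<close>. One vector thus tests both functionals at once.\<close>

lemma norm_add_norm_le_open_mass:
  assumes f: "f \<in> R" "fsupp f \<subseteq> A" "\<And>x. \<bar>f x\<bar> \<le> 1" and g: "g \<in> R" "fsupp g \<subseteq> A" "\<And>x. \<bar>g x\<bar> \<le> 1"
    and disj: "fsupp f \<inter> fsupp g = {}" and A: "open A"
  shows "norm (T f) + norm (T g) \<le> open_mass A"
proof -
  have *: "blinfun_apply (T f) v + blinfun_apply (T g) w \<le> open_mass A"
    if "norm v \<le> 1" "norm w \<le> 1" for v w
  proof -
    let ?u = "smul f v + smul g w"
    have "local_norm R smul (- (fsupp f \<union> fsupp g)) ?u = 0"
    proof (rule local_norm_eq_zeroI)
      fix h assume h: "h \<in> R" "fsupp h \<subseteq> - (fsupp f \<union> fsupp g)"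
      then have "h x = 0 \<or> f x = 0" "h x = 0 \<or> g x = 0" for x
        using zero_outside_fsupp by blast+
      then show "smul h ?u = 0" using f g h by (simp add: smul_add_right smul_smul_eq_zero)
    qed
    then have "supported_in R smul ?u A"
      unfolding supported_in_def using f g
      by (intro exI[of _ "fsupp f \<union> fsupp g"]) (auto simp: closed_fsupp)
    then have "blinfun_apply F ?u \<le> open_mass A"
      using f g disj that A by (intro apply_le_open_mass norm_add_smul_le_one)
    then show ?thesis using f g by (simp add: multiplied_apply blinfun.add_right)
  qed
  \<comment> \<open>The suprema are taken one after the other: over \<open>v\<close> with
    \<open>w\<close> fixed, then over \<open>w\<close>.\<close>
  have "norm (T f) \<le> open_mass A - blinfun_apply (T g) w" if "norm w \<le> 1" for w
    by (rule norm_blinfun_leI) (use *[OF _ that] in \<open>simp add: le_diff_eq\<close>)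
  then have "norm (T g) \<le> open_mass A - norm (T f)"
    by (intro norm_blinfun_leI) (simp add: algebra_simps)
  then show ?thesis by simp
qed

lemma functional_measure_exists: "\<exists>\<mu>. is_functional_measure R smul F \<mu>"
proof -
  have "\<exists>\<mu>. sets \<mu> = sets borel \<and> (\<forall>A. open A \<longrightarrow> emeasure \<mu> A = ennreal (open_mass A))"
  proof (rule measure_from_open_sets)
    fix A :: "nat \<Rightarrow> 'x set" assume A: "\<And>n. open (A n)"
    show "ennreal (open_mass (\<Union>n. A n)) \<le> (\<Sum>n. ennreal (open_mass (A n)))"
    proof (cases "(\<Sum>n. ennreal (open_mass (A n)))")
      case (real L)
      have L: "(\<Sum>i<n. open_mass (A i)) \<le> L" for n
      proof -
        have "ennreal (\<Sum>i<n. open_mass (A i)) = (\<Sum>i<n. ennreal (open_mass (A i)))"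
          by (simp add: sum_ennreal open_mass_nonneg)
        also have "\<dots> \<le> ennreal L" unfolding real(2)[symmetric] by (rule sum_le_suminf) auto
        finally show ?thesis using real(1) by simp
      qed
      have "open_mass (\<Union>n. A n) \<le> L"
      proof (intro open_mass_leI norm_blinfun_leI)
        fix f and v :: 'v assume f: "f \<in> R" "fsupp f \<subseteq> (\<Union>n. A n)" "\<And>x. \<bar>f x\<bar> \<le> 1" and v: "norm v \<le> 1"
        \<comment> \<open>The closed set to be covered is \<open>fsupp f\<close>, outside which
          \<open>smul f v\<close> has local norm 0.\<close>
        have "\<bar>blinfun_apply F (smul f v)\<bar> \<le> L * norm (smul f v)"
          by (rule abs_apply_le_of_cover[OF closed_fsupp local_norm_smul_eq_zero[OF f(1)] A f(2) L]) simp
        also have "\<dots> \<le> L * 1"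
          using norm_smul_le'[OF f(1,3), of v] v real(1) by (intro mult_left_mono) auto
        finally show "blinfun_apply (T f) v \<le> L" using f by (simp add: multiplied_apply)
      qed
      then show ?thesis unfolding real(2) by (rule ennreal_leI)
    qed simp
  next
    fix E U :: "'x set" and c assume E: "open E" and U: "open U" and c: "c < ennreal (open_mass (E \<inter> U))"
    obtain r where r: "0 \<le> r" "c = ennreal r" using c by (cases c) auto
    then have "r < open_mass (E \<inter> U)" using c by (simp add: ennreal_less_iff)
    then obtain f where f: "f \<in> R" "fsupp f \<subseteq> E \<inter> U" "\<And>x. \<bar>f x\<bar> \<le> 1" "r < norm (T f)"
      unfolding open_mass_def less_cSUP_iff[OF open_mass_domain_nonempty bdd_above_open_mass] by blast
    \<comment> \<open>Since \<open>f\<close> carries more than \<open>r\<close> of the mass of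
      \<open>E \<inter> U\<close>, the set \<open>E - fsupp f\<close> serves as \<open>W\<close>:
      multipliers supported there have supports disjoint from that of \<open>f\<close>.\<close>
    have "open_mass (E - fsupp f) \<le> open_mass E - norm (T f)"
    proof (rule open_mass_leI)
      fix g assume g: "g \<in> R" "fsupp g \<subseteq> E - fsupp f" "\<And>x. \<bar>g x\<bar> \<le> 1"
      have "fsupp f \<subseteq> E" "fsupp g \<subseteq> E" "fsupp f \<inter> fsupp g = {}" using f(2) g(2) by auto
      then show "norm (T g) \<le> open_mass E - norm (T f)"
        using norm_add_norm_le_open_mass[OF f(1) _ f(3) g(1) _ g(3) _ E] by linarith
    qed
    then have "r + open_mass (E - fsupp f) \<le> open_mass E" using f(4) by linarith
    then have "c + ennreal (open_mass (E - fsupp f)) \<le> ennreal (open_mass E)"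
      unfolding r(2) ennreal_plus[OF r(1) open_mass_nonneg, symmetric] by (rule ennreal_leI)
    moreover have "open (E - fsupp f)" using E by (simp add: closed_fsupp open_Diff)
    ultimately show "\<exists>W. open W \<and> E - U \<subseteq> W \<and> c + ennreal (open_mass W) \<le> ennreal (open_mass E)"
      using f(2) by (intro exI[of _ "E - fsupp f"]) auto
  next
    show "ennreal (open_mass {}) = 0" by (simp add: open_mass_empty)
    show "ennreal (open_mass A) \<le> ennreal (open_mass B)" if "A \<subseteq> B" for A B
      using that by (intro ennreal_leI open_mass_mono)
  qed
  then obtain \<mu> where "sets \<mu> = sets borel \<and> (\<forall>A. open A \<longrightarrow> emeasure \<mu> A = ennreal (open_mass A))"
    by (rule exE)
  then have \<mu>: "sets \<mu> = sets borel" "\<And>A. open A \<Longrightarrow> emeasure \<mu> A = ennreal (open_mass A)"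
    by simp_all
  have "space \<mu> = UNIV" using sets_eq_imp_space_eq[OF \<mu>(1)] by simp
  then have "finite_measure \<mu>" by (intro finite_measureI) (simp add: \<mu>)
  then have "is_functional_measure R smul F \<mu>"
    using \<mu> by (simp add: is_functional_measure_def open_mass_eq_Sup)
  then show ?thesis by (rule exI)
qed

end

text \<open>The open sets form an intersection-stable generator containing the whole space, whose
  mass is finite.\<close>

lemma functional_measure_unique:
  assumes "is_functional_measure R smul F \<mu>" "is_functional_measure R smul F \<nu>"
  shows "\<mu> = \<nu>"
proof (rule measure_eqI_generator_eq[where E = "Collect open" and \<Omega> = UNIV and A = "\<lambda>_. UNIV"])
  have *: "sets \<mu> = sets borel" "sets \<nu> = sets borel"
    "\<And>A. open A \<Longrightarrow> emeasure \<mu> A = emeasure \<nu> A" "finite_measure \<mu>"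
    using assms by (simp_all add: is_functional_measure_def)
  then show "sets \<mu> = sigma_sets UNIV (Collect open)" "sets \<nu> = sigma_sets UNIV (Collect open)"
    by (simp_all add: borel_def)
  show "emeasure \<mu> X = emeasure \<nu> X" if "X \<in> Collect open" for X
    using * that by simp
  show "emeasure \<mu> UNIV \<noteq> \<infinity>"
    using finite_measure.emeasure_finite[OF *(4)] by simp
qed (auto simp: Int_stable_def)

subsection \<open>Integral estimates\<close>

text \<open>Fewer than y/\<epsilon> + 2 levels are counted. The shift \<open>j - 1\<close> is the
  price of enclosing the closed set where f \<ge> j\<epsilon> in an open superlevel set.\<close>

lemma sum_indicator_superlevel_le:
  fixes \<epsilon> y :: real
  assumes "0 \<le> y" "0 < \<epsilon>"
  shows "(\<Sum>j<n. \<epsilon> * indicator {y. (real j - 1) * \<epsilon> < y} y) \<le> y + 2 * \<epsilon>"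
proof -
  \<comment> \<open>The bound \<open>real n * \<epsilon>\<close> strengthens the induction: if level
    \<open>n\<close> is counted, then (n+1)\<epsilon> < y + 2\<epsilon>.\<close>
  have "(\<Sum>j<n. \<epsilon> * indicator {y. (real j - 1) * \<epsilon> < y} y) \<le> min (y + 2 * \<epsilon>) (real n * \<epsilon>)"
    by (induction n) (use assms in \<open>auto simp: algebra_simps indicator_def of_bool_def\<close>)
  then show ?thesis by simp
qed

section \<open>Integration against the functional measure\<close>

locale tight_functional_measure = tight_functional R smul F
  for R :: "('x::topological_space \<Rightarrow> real) set" and smul :: "('x \<Rightarrow> real) \<Rightarrow> 'v::real_normed_vector \<Rightarrow> 'v"
    and F :: "'v \<Rightarrow>\<^sub>L real" +
  fixes \<mu> :: "'x measure"
  assumes functional_measure: "is_functional_measure R smul F \<mu>"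
begin

lemma sets_\<mu> [measurable_cong, simp]: "sets \<mu> = sets borel"
  using functional_measure by (simp add: is_functional_measure_def)

lemma space_\<mu> [simp]: "space \<mu> = UNIV"
  using sets_eq_imp_space_eq[OF sets_\<mu>] by simp

sublocale finite_measure \<mu>
  using functional_measure by (simp add: is_functional_measure_def)

lemma measure_open: "open A \<Longrightarrow> measure \<mu> A = open_mass A"
  using functional_measure
  by (simp add: is_functional_measure_def measure_def open_mass_nonneg flip: open_mass_eq_Sup)

lemma measurable_mem: "f \<in> R \<Longrightarrow> f \<in> borel_measurable \<mu>"
  using borel_measurable_continuous_onI[OF continuous_mem]
  by (simp add: measurable_cong_sets[OF sets_\<mu> refl])

lemma integrable_mem: "f \<in> R \<Longrightarrow> integrable \<mu> f"
  by (rule integrable_const_bound[of _ "sup_norm f"])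
    (auto simp: abs_le_sup_norm measurable_mem)

lemma integrable_indicator_borel: "A \<in> sets borel \<Longrightarrow> integrable \<mu> (indicator A :: 'x \<Rightarrow> real)"
  by (simp add: integrable_real_indicator emeasure_finite less_top[symmetric])

lemma integrable_diff_indicator:
  "f \<in> R \<Longrightarrow> A \<in> sets borel \<Longrightarrow> integrable \<mu> (\<lambda>x. \<bar>f x - indicator A x\<bar>)"
  by (intro integrable_abs Bochner_Integration.integrable_diff integrable_mem integrable_indicator_borel)

text \<open>The j-th horizontal slice of height \<epsilon>, divided by \<epsilon>, is an admissible
  multiplier for the open set \<open>U j\<close>, so it contributes at most \<epsilon> times the
  measure of \<open>U j\<close>. Summing the levels overshoots the integral by at most 2\<epsilon>
  times the total mass.\<close>

lemma norm_multiplied_le_integral_nonneg: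
  assumes f: "f \<in> R" and nonneg: "\<And>x. 0 \<le> f x"
  shows "norm (T f) \<le> (\<integral>x. f x \<partial>\<mu>)"
proof -
  have *: "norm (T f) \<le> (\<integral>x. f x \<partial>\<mu>) + 2 * \<epsilon> * measure \<mu> UNIV" if \<epsilon>: "0 < \<epsilon>" for \<epsilon>
  proof -
    \<comment> \<open>The top level lies above \<open>f\<close>, so that the slices telescope to all
      of \<open>f\<close>.\<close>
    obtain n :: nat where n: "sup_norm f < real n * \<epsilon>" using \<epsilon> ex_less_of_nat_mult by blast
    define g where "g j = (\<lambda>x. min (f x) (real (Suc j) * \<epsilon>) - min (f x) (real j * \<epsilon>))" for j
    define U where "U j = {x. (real j - 1) * \<epsilon> < f x}" for j
    have g: "g j \<in> R" for j
      unfolding g_def by (rule diff_mem[OF min_mem[OF f const_mem] min_mem[OF f const_mem]])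
    have U: "open (U j)" for j
      unfolding U_def by (intro open_Collect_less continuous_on_const continuous_mem f)
    have [measurable]: "U j \<in> sets borel" for j using U by simp
    have norm_g: "norm (T (g j)) \<le> \<epsilon> * measure \<mu> (U j)" for j
    proof -
      have "fsupp (\<lambda>x. g j x / \<epsilon>) \<subseteq> {x. real j * \<epsilon> \<le> f x}"
        by (rule fsupp_subsetI)
          (use \<epsilon> in \<open>auto simp: g_def min_def algebra_simps intro!: closed_Collect_le continuous_mem[OF f] continuous_on_const\<close>)
      also have "\<dots> \<subseteq> U j"
        using \<epsilon> by (auto simp: U_def algebra_simps)
      finally have supp: "fsupp (\<lambda>x. g j x / \<epsilon>) \<subseteq> U j" .
      have "\<bar>g j x / \<epsilon>\<bar> \<le> 1" for x
        using \<epsilon> by (auto simp: g_def min_def algebra_simps)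
      then have "norm (T (\<lambda>x. g j x / \<epsilon>)) \<le> open_mass (U j)"
        using cmult_mem[OF g, of "1 / \<epsilon>"] supp by (intro norm_le_open_mass) simp_all
      then have "\<epsilon> * norm (T (\<lambda>x. g j x / \<epsilon>)) \<le> \<epsilon> * measure \<mu> (U j)"
        using \<epsilon> by (simp add: measure_open[OF U])
      then show ?thesis using norm_multiplied_scale[OF g \<epsilon>] by (rule order_trans[rotated])
    qed
    have "(\<Sum>j<n. g j x) = f x" for x
    proof -
      have "(\<Sum>j<n. g j x) = min (f x) (real n * \<epsilon>) - min (f x) (real 0 * \<epsilon>)"
        unfolding g_def by (rule sum_lessThan_telescope)
      then show ?thesis using n abs_le_sup_norm[OF f, of x] nonneg[of x] by simp
    qed
    then have "T f = (\<Sum>j<n. T (g j))"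
      using multiplied_sum[of "{..<n}" g F] g by simp
    then have "norm (T f) \<le> (\<Sum>j<n. norm (T (g j)))" by (simp add: norm_sum)
    also have "\<dots> \<le> (\<Sum>j<n. \<epsilon> * measure \<mu> (U j))" by (intro sum_mono norm_g)
    also have "\<dots> = (\<integral>x. (\<Sum>j<n. \<epsilon> * indicator (U j) x) \<partial>\<mu>)"
      by (subst Bochner_Integration.integral_sum) (simp_all add: integrable_indicator_borel)
    also have "\<dots> \<le> (\<integral>x. f x + 2 * \<epsilon> \<partial>\<mu>)"
    proof (rule integral_mono)
      fix x
      show "(\<Sum>j<n. \<epsilon> * indicator (U j) x) \<le> f x + 2 * \<epsilon>"
        using sum_indicator_superlevel_le[OF nonneg[of x] \<epsilon>, of n] by (simp add: U_def indicator_def)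
    qed (intro Bochner_Integration.integrable_add Bochner_Integration.integrable_sum
        integrable_mult_right integrable_mem[OF f] integrable_indicator_borel integrable_const borel_open U)+
    also have "\<dots> = (\<integral>x. f x \<partial>\<mu>) + 2 * \<epsilon> * measure \<mu> UNIV"
      by (subst Bochner_Integration.integral_add) (auto intro!: integrable_mem[OF f])
    finally show ?thesis .
  qed
  define M where "M = measure \<mu> UNIV"
  have M: "0 \<le> M" by (simp add: M_def)
  show ?thesis
  proof (rule field_le_epsilon)
    fix e :: real assume e: "0 < e"
    \<comment> \<open>Adding 1 keeps the denominator positive when the total mass is 0.\<close>
    define \<delta> where "\<delta> = e / (2 * (M + 1))"
    have "0 < \<delta>" "2 * \<delta> * M \<le> e"
      using e M by (simp_all add: \<delta>_def field_simps)
    then show "norm (T f) \<le> (\<integral>x. f x \<partial>\<mu>) + e"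
      using *[of \<delta>] unfolding M_def by linarith
  qed
qed

text \<open>Positive and negative parts stay in the lattice \<open>R\<close>, and their integrals
  add up to that of the absolute value.\<close>

lemma norm_multiplied_le_integral:
  assumes f: "f \<in> R"
  shows "norm (T f) \<le> (\<integral>x. \<bar>f x\<bar> \<partial>\<mu>)"
proof -
  define p q where "p = (\<lambda>x. max (f x) 0)" and "q = (\<lambda>x. max (- f x) 0)"
  have pq: "p \<in> R" "q \<in> R"
    unfolding p_def q_def by (rule max_mem[OF f const_mem] max_mem[OF uminus_mem[OF f] const_mem])+
  have "f = (\<lambda>x. p x - q x)" by (auto simp: p_def q_def max_def)
  then have "norm (T f) \<le> norm (T p) + norm (T q)"
    using multiplied_diff[OF pq, of F] norm_triangle_ineq4[of "T p" "T q"] by simp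
  also have "\<dots> \<le> (\<integral>x. p x \<partial>\<mu>) + (\<integral>x. q x \<partial>\<mu>)"
    by (intro add_mono norm_multiplied_le_integral_nonneg pq) (auto simp: p_def q_def)
  also have "\<dots> = (\<integral>x. p x + q x \<partial>\<mu>)"
    using pq by (simp add: integrable_mem)
  also have "(\<lambda>x. p x + q x) = (\<lambda>x. \<bar>f x\<bar>)" by (auto simp: p_def q_def max_def)
  finally show ?thesis .
qed

lemma norm_multiplied_diff_le_integral:
  assumes "f \<in> R" "g \<in> R" "A \<in> sets borel"
  shows "norm (T f - T g) \<le> (\<integral>x. \<bar>f x - indicator A x\<bar> \<partial>\<mu>) + (\<integral>x. \<bar>g x - indicator A x\<bar> \<partial>\<mu>)"
proof -
  have "norm (T f - T g) \<le> (\<integral>x. \<bar>f x - g x\<bar> \<partial>\<mu>)"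
    using norm_multiplied_le_integral[OF diff_mem[OF assms(1,2)]] assms by (simp add: multiplied_diff)
  also have "\<dots> \<le> (\<integral>x. \<bar>f x - indicator A x\<bar> + \<bar>g x - indicator A x\<bar> \<partial>\<mu>)"
    using assms
    by (intro integral_mono Bochner_Integration.integrable_add integrable_diff_indicator integrable_abs
        integrable_mem diff_mem) auto
  also have "\<dots> = (\<integral>x. \<bar>f x - indicator A x\<bar> \<partial>\<mu>) + (\<integral>x. \<bar>g x - indicator A x\<bar> \<partial>\<mu>)"
    using assms by (intro Bochner_Integration.integral_add integrable_diff_indicator)
  finally show ?thesis .
qed

lemma open_approximation_integral:
  assumes A: "open A" and f: "\<And>k. f k \<in> R" "\<And>k x. 0 \<le> f k x" "\<And>k x. f k x \<le> 1"
    "\<And>x. (\<lambda>k. f k x) \<longlonglongrightarrow> indicator A x"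
  shows "(\<lambda>k. \<integral>x. \<bar>f k x - indicator A x\<bar> \<partial>\<mu>) \<longlonglongrightarrow> 0"
proof -
  have [measurable]: "A \<in> sets borel" using A by simp
  have [measurable]: "f k \<in> borel_measurable \<mu>" for k by (rule measurable_mem[OF f(1)])
  have "(\<lambda>k. \<integral>x. \<bar>f k x - indicator A x\<bar> \<partial>\<mu>) \<longlonglongrightarrow> (\<integral>x. (0 :: real) \<partial>\<mu>)"
  proof (rule integral_dominated_convergence)
    show "integrable \<mu> (\<lambda>_. 1 :: real)" by simp
    show "AE x in \<mu>. (\<lambda>k. \<bar>f k x - indicator A x\<bar>) \<longlonglongrightarrow> 0"
      using tendsto_rabs_zero[OF LIM_zero[OF f(4)]] by simp
    show "AE x in \<mu>. norm \<bar>f k x - indicator A x\<bar> \<le> 1" for k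
    proof (intro always_eventually allI)
      show "norm \<bar>f k x - indicator A x\<bar> \<le> 1" for x
        using f(2)[of k x] f(3)[of k x] by (cases "x \<in> A") auto
    qed
  qed (use A f in \<open>auto intro!: borel_measurable_integrable[OF integrable_diff_indicator]\<close>)
  then show ?thesis by simp
qed

lemma measure_tail_tendsto:
  assumes "range A \<subseteq> sets borel" "disjoint_family A"
  shows "(\<lambda>n. measure \<mu> ((\<Union>i. A i) - (\<Union>i<n. A i))) \<longlonglongrightarrow> 0"
proof -
  have A[measurable]: "A i \<in> sets borel" for i using assms(1) by auto
  have "(\<lambda>n. measure \<mu> (\<Union>i. A i) - (\<Sum>i<n. measure \<mu> (A i))) \<longlonglongrightarrow> measure \<mu> (\<Union>i. A i) - measure \<mu> (\<Union>i. A i)"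
    using finite_measure_UNION[of A] assms by (intro tendsto_diff tendsto_const) (simp add: sums_def)
  moreover have "measure \<mu> ((\<Union>i. A i) - (\<Union>i<n. A i)) = measure \<mu> (\<Union>i. A i) - (\<Sum>i<n. measure \<mu> (A i))" for n
  proof -
    have "disjoint_family_on A {..<n}" using assms(2) by (rule disjoint_family_on_mono[rotated]) simp
    then have "measure \<mu> (\<Union>i<n. A i) = (\<Sum>i<n. measure \<mu> (A i))"
      by (intro finite_measure_finite_Union) auto
    moreover have "measure \<mu> ((\<Union>i. A i) - (\<Union>i<n. A i)) = measure \<mu> (\<Union>i. A i) - measure \<mu> (\<Union>i<n. A i)"
      by (rule finite_measure_Diff) auto
    ultimately show ?thesis by simp
  qed
  ultimately show ?thesis by simp
qed

text \<open>A Dynkin class argument: open sets are reached by dominated convergence, complements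
  through 1 - f, and disjoint unions by adding approximants of finitely many members and discarding
  a tail of small measure.\<close>

lemma indicator_approximation:
  assumes "A \<in> sets borel" "0 < \<epsilon>"
  shows "\<exists>f\<in>R. (\<integral>x. \<bar>f x - indicator A x\<bar> \<partial>\<mu>) < \<epsilon>"
proof -
  have "Int_stable (Collect open :: 'x set set)" "Collect open \<subseteq> Pow (UNIV :: 'x set)"
    "A \<in> sigma_sets UNIV (Collect open)"
    using assms(1) by (auto simp: Int_stable_def borel_def)
  \<comment> \<open>The accuracy is quantified inside the induction because the union case needs a
    finer one from its members.\<close>
  then have "\<forall>\<epsilon>>0. \<exists>f\<in>R. (\<integral>x. \<bar>f x - indicator A x\<bar> \<partial>\<mu>) < \<epsilon>"
  proof (induction rule: sigma_sets_induct_disjoint)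
    case (basic A)
    then have "open A" by simp
    from open_approximation[OF this]
    obtain f where f: "\<And>k. f k \<in> R" "\<And>k. fsupp (f k) \<subseteq> A" "\<And>k x. 0 \<le> f k x" "\<And>k x. f k x \<le> 1"
      "\<And>x. incseq (\<lambda>k. f k x)" "\<And>x. (\<lambda>k. f k x) \<longlonglongrightarrow> indicator A x" by metis
    show ?case
    proof (intro allI impI)
      fix \<epsilon> :: real assume "0 < \<epsilon>"
      with open_approximation_integral[OF \<open>open A\<close> f(1,3,4,6)]
      have "\<forall>\<^sub>F k in sequentially. (\<integral>x. \<bar>f k x - indicator A x\<bar> \<partial>\<mu>) < \<epsilon>" by (rule order_tendstoD)
      then show "\<exists>f\<in>R. (\<integral>x. \<bar>f x - indicator A x\<bar> \<partial>\<mu>) < \<epsilon>"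
        using f(1) by (auto dest!: eventually_happens)
    qed
  next
    case empty
    show ?case by (auto intro!: bexI[of _ "\<lambda>_. 0"] const_mem)
  next
    case (compl A)
    show ?case
    proof (intro allI impI)
      fix \<epsilon> :: real assume "0 < \<epsilon>"
      then obtain f where f: "f \<in> R" "(\<integral>x. \<bar>f x - indicator A x\<bar> \<partial>\<mu>) < \<epsilon>" using compl by blast
      have "\<bar>(1 - f x) - indicator (UNIV - A) x\<bar> = \<bar>f x - indicator A x\<bar>" for x
        by (cases "x \<in> A") auto
      then show "\<exists>f\<in>R. (\<integral>x. \<bar>f x - indicator (UNIV - A) x\<bar> \<partial>\<mu>) < \<epsilon>"
        using f(2) by (intro bexI[OF _ diff_mem[OF one_mem f(1)]]) simp
    qed
  next
    case (union A)
    have A: "A i \<in> sets borel" for i using union(2) by (auto simp: borel_def)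
    have [measurable]: "A i \<in> sets borel" for i by (rule A)
    have range: "range A \<subseteq> sets borel" using A by auto
    show ?case
    proof (intro allI impI)
      fix \<epsilon> :: real assume \<epsilon>: "0 < \<epsilon>"
      then have "0 < \<epsilon> / 2" by simp
      from order_tendstoD(2)[OF measure_tail_tendsto[OF range union(1)] this]
      obtain n where n: "measure \<mu> ((\<Union>i. A i) - (\<Union>i<n. A i)) < \<epsilon> / 2"
        by (auto dest!: eventually_happens)
      \<comment> \<open>Dividing by \<open>Suc n\<close> leaves at most \<epsilon>/2 for the
        \<open>n\<close> terms together and is safe for n = 0.\<close>
      have "\<forall>i. \<exists>f\<in>R. (\<integral>x. \<bar>f x - indicator (A i) x\<bar> \<partial>\<mu>) < \<epsilon> / 2 / Suc n"
        using union(3) \<epsilon> by simp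
      then obtain f where f: "\<And>i. f i \<in> R"
        "\<And>i. (\<integral>x. \<bar>f i x - indicator (A i) x\<bar> \<partial>\<mu>) < \<epsilon> / 2 / Suc n"
        by metis
      let ?g = "\<lambda>x. \<Sum>i<n. f i x"
      let ?D = "(\<Union>i. A i) - (\<Union>i<n. A i)"
      have g: "?g \<in> R" by (intro sum_mem f)
      have le: "\<bar>?g x - indicator (\<Union>i. A i) x\<bar> \<le> (\<Sum>i<n. \<bar>f i x - indicator (A i) x\<bar>) + indicator ?D x" for x
      proof -
        have "disjoint_family_on A {..<n}" using union(1) by (rule disjoint_family_on_mono[rotated]) simp
        then have "indicator (\<Union>i<n. A i) x = (\<Sum>i<n. indicator (A i) x :: real)"
          by (intro indicator_UN_disjoint) auto
        moreover have "indicator (\<Union>i. A i) x = indicator (\<Union>i<n. A i) x + (indicator ?D x :: real)"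
          by (auto simp: indicator_def)
        ultimately have "?g x - indicator (\<Union>i. A i) x = (\<Sum>i<n. f i x - indicator (A i) x) - indicator ?D x"
          by (simp add: sum_subtractf)
        also have "\<bar>\<dots>\<bar> \<le> \<bar>\<Sum>i<n. f i x - indicator (A i) x\<bar> + indicator ?D x"
          using abs_triangle_ineq4[of "\<Sum>i<n. f i x - indicator (A i) x" "indicator ?D x"] by simp
        also have "\<dots> \<le> (\<Sum>i<n. \<bar>f i x - indicator (A i) x\<bar>) + indicator ?D x"
          by (intro add_right_mono sum_abs)
        finally show ?thesis .
      qed
      have int: "integrable \<mu> (\<lambda>x. \<Sum>i<n. \<bar>f i x - indicator (A i) x\<bar>)"
        using f A by (intro Bochner_Integration.integrable_sum integrable_diff_indicator)
      have "(\<integral>x. \<bar>?g x - indicator (\<Union>i. A i) x\<bar> \<partial>\<mu>)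
          \<le> (\<integral>x. (\<Sum>i<n. \<bar>f i x - indicator (A i) x\<bar>) + indicator ?D x \<partial>\<mu>)"
        by (intro integral_mono le integrable_diff_indicator g Bochner_Integration.integrable_add int
            integrable_indicator_borel) measurable
      also have "\<dots> = (\<Sum>i<n. \<integral>x. \<bar>f i x - indicator (A i) x\<bar> \<partial>\<mu>) + measure \<mu> ?D"
      proof -
        have "?D \<in> sets borel" by measurable
        then show ?thesis
          using f A by (simp add: int integrable_indicator_borel integrable_diff_indicator)
      qed
      also have "\<dots> < \<epsilon> / 2 + \<epsilon> / 2"
      proof (rule add_le_less_mono[OF _ n])
        have "(\<Sum>i<n. \<integral>x. \<bar>f i x - indicator (A i) x\<bar> \<partial>\<mu>) \<le> (\<Sum>i<n. \<epsilon> / 2 / Suc n)"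
          by (intro sum_mono less_imp_le f)
        also have "\<dots> \<le> \<epsilon> / 2" using \<epsilon> by (simp add: field_simps)
        finally show "(\<Sum>i<n. \<integral>x. \<bar>f i x - indicator (A i) x\<bar> \<partial>\<mu>) \<le> \<epsilon> / 2" .
      qed
      finally show "\<exists>f\<in>R. (\<integral>x. \<bar>f x - indicator (\<Union>i. A i) x\<bar> \<partial>\<mu>) < \<epsilon>"
        using g by auto
    qed
  qed
  then show ?thesis using assms(2) by blast
qed

end

subsection \<open>The vector measure of a tight functional\<close>

context tight_functional_measure
begin

text \<open>Approximants in L1 of the indicator are mapped to a Cauchy sequence in the complete dual
  space. The estimate against an arbitrary \<open>f\<close> survives the passage to its limit
  \<open>L\<close>.\<close>

lemma indicator_extension_exists:
  assumes A: "A \<in> sets borel"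
  shows "\<exists>L. \<forall>f\<in>R. norm (T f - L) \<le> (\<integral>x. \<bar>f x - indicator A x\<bar> \<partial>\<mu>)"
proof -
  define d where "d f = (\<integral>x. \<bar>f x - indicator A x\<bar> \<partial>\<mu>)" for f :: "'x \<Rightarrow> real"
  have "\<forall>k. \<exists>f\<in>R. d f < inverse (real (Suc k))"
    unfolding d_def using indicator_approximation[OF A] by simp
  then obtain f where f: "\<And>k. f k \<in> R" "\<And>k. d (f k) < inverse (real (Suc k))" by metis
  have d_f: "(\<lambda>k. d (f k)) \<longlonglongrightarrow> 0"
  proof (rule tendsto_sandwich[OF _ _ tendsto_const LIMSEQ_inverse_real_of_nat])
    show "\<forall>\<^sub>F k in sequentially. 0 \<le> d (f k)" by (simp add: d_def)
    show "\<forall>\<^sub>F k in sequentially. d (f k) \<le> inverse (real (Suc k))"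
      using f(2) by (simp add: less_imp_le)
  qed
  have diff: "norm (T g - T h) \<le> d g + d h" if "g \<in> R" "h \<in> R" for g h
    unfolding d_def by (rule norm_multiplied_diff_le_integral[OF that A])
  have "Cauchy (\<lambda>k. T (f k))"
  proof (rule CauchyI)
    fix e :: real assume "0 < e"
    then have "\<forall>\<^sub>F k in sequentially. d (f k) < e / 2"
      by (intro order_tendstoD(2)[OF d_f]) simp
    then obtain K where "\<And>k. K \<le> k \<Longrightarrow> d (f k) < e / 2" by (auto simp: eventually_sequentially)
    then have "norm (T (f m) - T (f n)) < e" if "K \<le> m" "K \<le> n" for m n
      using diff[OF f(1)[of m] f(1)[of n]] that by (smt (verit) field_sum_of_halves)
    then show "\<exists>M. \<forall>m\<ge>M. \<forall>n\<ge>M. norm (T (f m) - T (f n)) < e" by blast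
  qed
  then obtain L where L: "(\<lambda>k. T (f k)) \<longlonglongrightarrow> L"
    using Cauchy_convergent convergent_def by blast
  have "norm (T g - L) \<le> d g" if g: "g \<in> R" for g
  proof (rule LIMSEQ_le)
    show "(\<lambda>k. norm (T g - T (f k))) \<longlonglongrightarrow> norm (T g - L)" by (intro tendsto_intros L)
    show "(\<lambda>k. d g + d (f k)) \<longlonglongrightarrow> d g"
      using tendsto_add[OF tendsto_const d_f] by simp
    show "\<exists>N. \<forall>k\<ge>N. norm (T g - T (f k)) \<le> d g + d (f k)" using diff g f(1) by blast
  qed
  then show ?thesis unfolding d_def by blast
qed

text \<open>\<open>SOME\<close> makes no real choice: by \<open>indicator_approximation\<close> the
  right-hand side can be made arbitrarily small, so the estimate determines
  \<open>L\<close>.\<close>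

definition functional_vector_measure :: "'x set \<Rightarrow> 'v \<Rightarrow>\<^sub>L real" (\<open>N\<close>)
  where "N = (\<lambda>A\<in>sets borel. SOME L. \<forall>f\<in>R. norm (T f - L) \<le> (\<integral>x. \<bar>f x - indicator A x\<bar> \<partial>\<mu>))"

lemma norm_multiplied_diff_N:
  assumes "A \<in> sets borel" "f \<in> R"
  shows "norm (T f - N A) \<le> (\<integral>x. \<bar>f x - indicator A x\<bar> \<partial>\<mu>)"
  using someI_ex[OF indicator_extension_exists[OF assms(1)]] assms
  by (simp add: functional_vector_measure_def)

lemma norm_N_le: "A \<in> sets borel \<Longrightarrow> norm (N A) \<le> measure \<mu> A"
  using norm_multiplied_diff_N[OF _ const_mem[of 0], of A] by (simp add: multiplied_zero)

lemma N_UNIV: "N UNIV = F"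
  using norm_multiplied_diff_N[OF _ one_mem, of UNIV] by (simp add: multiplied_one)

text \<open>Disjointness makes the indicator of the union the sum of the two indicators, so sums of
  approximants approximate it, and \<open>T\<close> is additive.\<close>

lemma N_Un:
  assumes A: "A \<in> sets borel" and B: "B \<in> sets borel" and disj: "A \<inter> B = {}"
  shows "N (A \<union> B) = N A + N B"
proof -
  have AB: "A \<union> B \<in> sets borel" using A B by simp
  have "norm (N (A \<union> B) - (N A + N B)) \<le> 0 + e" if e: "0 < e" for e
  proof -
    \<comment> \<open>The errors for \<open>A\<close>, \<open>B\<close> and
      \<open>A \<union> B\<close> are e/4, e/4 and e/4 + e/4.\<close>
    obtain f where f: "f \<in> R" "(\<integral>x. \<bar>f x - indicator A x\<bar> \<partial>\<mu>) < e / 4"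
      using indicator_approximation[OF A, of "e / 4"] e by auto
    obtain g where g: "g \<in> R" "(\<integral>x. \<bar>g x - indicator B x\<bar> \<partial>\<mu>) < e / 4"
      using indicator_approximation[OF B, of "e / 4"] e by auto
    let ?h = "\<lambda>x. f x + g x"
    have h: "?h \<in> R" by (intro add_mem f g)
    have "(\<integral>x. \<bar>?h x - indicator (A \<union> B) x\<bar> \<partial>\<mu>)
        \<le> (\<integral>x. \<bar>f x - indicator A x\<bar> + \<bar>g x - indicator B x\<bar> \<partial>\<mu>)"
    proof (rule integral_mono)
      show "\<bar>?h x - indicator (A \<union> B) x\<bar> \<le> \<bar>f x - indicator A x\<bar> + \<bar>g x - indicator B x\<bar>" for x
        using disj by (auto simp: indicator_def)
    qed (intro integrable_diff_indicator Bochner_Integration.integrable_add f g h A B AB)+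
    also have "\<dots> = (\<integral>x. \<bar>f x - indicator A x\<bar> \<partial>\<mu>) + (\<integral>x. \<bar>g x - indicator B x\<bar> \<partial>\<mu>)"
      by (intro Bochner_Integration.integral_add integrable_diff_indicator f g A B)
    finally have "norm (T ?h - N (A \<union> B)) \<le> e / 4 + e / 4"
      using norm_multiplied_diff_N[OF AB h] f g by linarith
    moreover have "norm (T f - N A) \<le> e / 4" "norm (T g - N B) \<le> e / 4"
      using norm_multiplied_diff_N[OF A f(1)] norm_multiplied_diff_N[OF B g(1)] f g by simp_all
    moreover have "norm (N (A \<union> B) - (N A + N B))
        \<le> norm (T f - N A) + norm (T g - N B) + norm (T ?h - N (A \<union> B))"
    proof -
      have eq: "N (A \<union> B) - (N A + N B) = (T f - N A) + (T g - N B) - (T ?h - N (A \<union> B))"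
        using f g by (simp add: multiplied_add)
      show ?thesis
        unfolding eq
        using norm_triangle_ineq4[of "(T f - N A) + (T g - N B)" "T ?h - N (A \<union> B)"]
          norm_triangle_ineq[of "T f - N A" "T g - N B"] by linarith
    qed
    ultimately show ?thesis by linarith
  qed
  then have "norm (N (A \<union> B) - (N A + N B)) \<le> 0" by (rule field_le_epsilon)
  then show ?thesis by simp
qed

lemma N_empty: "N {} = 0"
  using norm_N_le[of "{}"] by simp

text \<open>By finite additivity the remainder of the series is the value of \<open>N\<close> on a
  tail, and its norm is at most the measure of that tail.\<close>

lemma N_sums:
  assumes "range A \<subseteq> sets borel" "disjoint_family A"
  shows "(\<lambda>i. N (A i)) sums N (\<Union>i. A i)"
proof -
  have A[measurable]: "A i \<in> sets borel" for i using assms(1) by auto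
  have partial: "N (\<Union>i<n. A i) = (\<Sum>i<n. N (A i))" for n
  proof (induction n)
    case (Suc n)
    have "(\<Union>i<n. A i) \<inter> A n = {}"
      using assms(2) by (auto simp: disjoint_family_on_def dest: less_imp_neq)
    then have "N ((\<Union>i<n. A i) \<union> A n) = N (\<Union>i<n. A i) + N (A n)"
      by (intro N_Un) measurable
    then show ?case using Suc.IH by (simp add: lessThan_Suc Un_commute)
  qed (simp add: N_empty)
  have "(\<lambda>n. N (\<Union>i. A i) - (\<Sum>i<n. N (A i))) \<longlonglongrightarrow> 0"
  proof (rule Lim_null_comparison[OF always_eventually measure_tail_tendsto[OF assms]], safe)
    fix n
    have "(\<Union>i<n. A i) \<union> ((\<Union>i. A i) - (\<Union>i<n. A i)) = (\<Union>i. A i)" by auto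
    moreover have sets: "(\<Union>i<n. A i) \<in> sets borel" "(\<Union>i. A i) - (\<Union>i<n. A i) \<in> sets borel"
      by measurable
    ultimately have "N (\<Union>i. A i) = N (\<Union>i<n. A i) + N ((\<Union>i. A i) - (\<Union>i<n. A i))"
      using N_Un[OF sets] by simp
    then have "N (\<Union>i. A i) - (\<Sum>i<n. N (A i)) = N ((\<Union>i. A i) - (\<Union>i<n. A i))"
      by (simp add: partial)
    then show "norm (N (\<Union>i. A i) - (\<Sum>i<n. N (A i))) \<le> measure \<mu> ((\<Union>i. A i) - (\<Union>i<n. A i))"
      using norm_N_le[OF sets(2)] by simp
  qed
  from tendsto_diff[OF tendsto_const[of "N (\<Union>i. A i)"] this] show ?thesis
    by (simp add: sums_def)
qed

lemma local_vector_measure_N: "local_vector_measure R smul N"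
  unfolding local_vector_measure_def dual_valued_measure_def
proof (intro conjI allI impI)
  show "N \<in> extensional (sets borel)" by (simp add: functional_vector_measure_def)
  show "(\<lambda>n. N (A n)) sums N (\<Union>n. A n)" if "range A \<subseteq> sets borel \<and> disjoint_family A" for A :: "nat \<Rightarrow> 'x set"
    using that by (intro N_sums) auto
next
  fix A and v :: 'v assume "open A \<and> local_norm R smul A v = 0"
  then have A: "open A" and v: "local_norm R smul A v = 0" by auto
  obtain f where f: "\<And>k. f k \<in> R" "\<And>k. fsupp (f k) \<subseteq> A" "\<And>k x. 0 \<le> f k x" "\<And>k x. f k x \<le> 1"
    "\<And>x. incseq (\<lambda>k. f k x)" "\<And>x. (\<lambda>k. f k x) \<longlonglongrightarrow> indicator A x"
    using open_approximation[OF A] by metis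
  have A': "A \<in> sets borel" using A by simp
  \<comment> \<open>\<open>N A\<close> is a norm limit of functionals \<open>T (f k)\<close> with
    supports inside \<open>A\<close>, and each of these annihilates \<open>v\<close>.\<close>
  have "(\<lambda>k. T (f k) - N A) \<longlonglongrightarrow> 0"
    by (rule Lim_null_comparison[OF always_eventually open_approximation_integral[OF A f(1,3,4,6)]])
      (intro allI norm_multiplied_diff_N A' f)
  then have "(\<lambda>k. T (f k)) \<longlonglongrightarrow> N A" by (rule LIM_zero_cancel)
  then have "(\<lambda>k. blinfun_apply (T (f k)) v) \<longlonglongrightarrow> blinfun_apply (N A) v"
    by (intro tendsto_intros)
  moreover have "blinfun_apply (T (f k)) v = 0" for k
    using smul_eq_zero_of_local_norm[OF v f(1,2)] f(3,4) by (simp add: multiplied_apply f(1))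
  ultimately show "blinfun_apply (N A) v = 0" by (simp add: LIMSEQ_const_iff)
qed

text \<open>The upper bounds on \<open>A\<close> and on its complement add up to the total mass,
  which is at most \<open>norm F\<close> and hence at most the sum of the two norms. Neither bound
  can be strict.\<close>

lemma norm_N_eq:
  assumes A: "A \<in> sets borel"
  shows "norm (N A) = measure \<mu> A"
proof (rule antisym)
  have "measure \<mu> UNIV = open_mass UNIV" by (rule measure_open) simp
  also have "\<dots> \<le> norm F" by (intro open_mass_leI norm_multiplied_le)
  also have "F = N A + N (- A)"
    using N_Un[OF A, of "- A"] A N_UNIV by (simp add: Compl_partition)
  also have "norm \<dots> \<le> norm (N A) + norm (N (- A))" by (rule norm_triangle_ineq)
  also have "norm (N (- A)) \<le> measure \<mu> (- A)" using A by (intro norm_N_le) simp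
  also have "measure \<mu> (- A) = measure \<mu> UNIV - measure \<mu> A"
    using finite_measure_compl[of A] A by (simp add: Compl_eq_Diff_UNIV)
  finally show "measure \<mu> A \<le> norm (N A)" by simp
qed (rule norm_N_le[OF A])

lemma total_variation_N:
  assumes E: "E \<in> sets borel"
  shows "total_variation N E = emeasure \<mu> E"
proof (rule antisym)
  show "total_variation N E \<le> emeasure \<mu> E"
    unfolding total_variation_def
  proof (rule SUP_least)
    fix \<pi> assume "\<pi> \<in> {\<pi>. finite \<pi> \<and> \<pi> \<subseteq> sets borel \<and> partition_on E \<pi>}"
    then have \<pi>: "finite \<pi>" "\<pi> \<subseteq> sets borel" "\<Union>\<pi> = E" "disjoint \<pi>"
      by (auto simp: partition_on_def)
    have "(\<Sum>A\<in>\<pi>. norm (N A)) = (\<Sum>A\<in>\<pi>. measure \<mu> A)"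
      using \<pi> by (intro sum.cong norm_N_eq) auto
    also have "\<dots> = measure \<mu> (\<Union>A\<in>\<pi>. A)"
      using \<pi> by (intro finite_measure_finite_Union[symmetric]) (auto simp: disjoint_family_on_def disjoint_def)
    finally show "ennreal (\<Sum>A\<in>\<pi>. norm (N A)) \<le> emeasure \<mu> E"
      using \<pi> by (simp add: emeasure_eq_measure)
  qed
  show "emeasure \<mu> E \<le> total_variation N E"
  \<comment> \<open>For nonempty \<open>E\<close> the one-block partition already attains the value;
    a partition has no empty block, so the empty set is treated apart.\<close>
  proof (cases "E = {}")
    case False
    then have "{E} \<in> {\<pi>. finite \<pi> \<and> \<pi> \<subseteq> sets borel \<and> partition_on E \<pi>}"
      using E by (auto simp: partition_on_def disjoint_def)
    then have "ennreal (\<Sum>A\<in>{E}. norm (N A)) \<le> total_variation N E"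
      unfolding total_variation_def by (rule SUP_upper)
    then show ?thesis using E by (simp add: norm_N_eq emeasure_eq_measure)
  qed simp
qed

end

subsection \<open>Uniqueness\<close>

context
  fixes N :: "'x::topological_space set \<Rightarrow> 'v::real_normed_vector \<Rightarrow>\<^sub>L real"
  assumes N: "dual_valued_measure N"
begin

lemma dual_valued_measure_sums:
  "range A \<subseteq> sets borel \<Longrightarrow> disjoint_family A \<Longrightarrow> (\<lambda>n. N (A n)) sums N (\<Union>n. A n)"
  using N by (simp add: dual_valued_measure_def)

text \<open>A constant series converges only if its term is 0. Finite additivity, obtained by
  padding with empty sets, depends on this.\<close>

lemma dual_valued_measure_empty: "N {} = 0"
proof -
  have "(\<lambda>_::nat. N {}) sums N {}"
    using dual_valued_measure_sums[of "\<lambda>_. {}"] by (simp add: disjoint_family_on_def)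
  then show ?thesis using summable_const_iff sums_summable by blast
qed

lemma dual_valued_measure_Un:
  assumes "A \<in> sets borel" "B \<in> sets borel" "A \<inter> B = {}"
  shows "N (A \<union> B) = N A + N B"
proof -
  have "(\<lambda>n. N (binaryset A B n)) sums N (\<Union>n. binaryset A B n)"
    using assms by (intro dual_valued_measure_sums)
      (auto simp: range_binaryset_eq disjoint_family_on_def binaryset_def)
  moreover have "(\<lambda>n. N (binaryset A B n)) sums (N A + N B)"
    by (rule binaryset_sums) (rule dual_valued_measure_empty)
  ultimately show ?thesis using sums_unique2 by (metis UN_binaryset_eq)
qed

text \<open>Disjointing \<open>U\<close> turns the values \<open>N (U n)\<close> into partial sums
  of a series that converges in the dual norm.\<close>

lemma dual_valued_measure_incseq:
  assumes "range U \<subseteq> sets borel" "incseq U"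
  shows "(\<lambda>n. N (U n)) \<longlonglongrightarrow> N (\<Union>n. U n)"
proof -
  have U: "U i \<in> sets borel" for i using assms(1) by auto
  have disj: "range (disjointed U) \<subseteq> sets borel"
    using assms(1) by (rule sets.range_disjointed_sets)
  have partial: "(\<Sum>i<Suc n. N (disjointed U i)) = N (U n)" for n
  proof (induction n)
    case (Suc n)
    have "U n \<union> (U (Suc n) - U n) = U (Suc n)" using incseq_SucD[OF assms(2), of n] by auto
    then show ?case
      using Suc.IH dual_valued_measure_Un[of "U n" "U (Suc n) - U n"] U
      by (simp add: disjointed_mono[OF assms(2)])
  qed (simp add: disjointed_def)
  have "(\<lambda>i. N (disjointed U i)) sums N (\<Union>n. U n)"
    using dual_valued_measure_sums[OF disj disjoint_family_disjointed] by (simp add: UN_disjointed_eq)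
  then have "(\<lambda>n. \<Sum>i<Suc n. N (disjointed U i)) \<longlonglongrightarrow> N (\<Union>n. U n)"
    unfolding sums_def by (rule LIMSEQ_Suc)
  then show ?thesis by (simp only: partial)
qed

end

lemma dual_valued_measure_eqI:
  fixes M N :: "'a::topological_space set \<Rightarrow> 'b::real_normed_vector \<Rightarrow>\<^sub>L real"
  assumes M: "dual_valued_measure M" and N: "dual_valued_measure N"
    and eq: "\<And>A. open A \<Longrightarrow> M A = N A"
  shows "M = N"
proof (rule extensionalityI[where A = "sets borel"])
  show "M \<in> extensional (sets borel)" "N \<in> extensional (sets borel)"
    using M N by (auto simp: dual_valued_measure_def)
  fix A :: "'a set" assume "A \<in> sets borel"
  then have "Int_stable (Collect open :: 'a set set)" "Collect open \<subseteq> Pow (UNIV :: 'a set)"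
    "A \<in> sigma_sets UNIV (Collect open)"
    by (auto simp: Int_stable_def borel_def)
  then show "M A = N A"
  proof (induction rule: sigma_sets_induct_disjoint)
    case (compl A)
    then have A: "A \<in> sets borel" by (simp add: borel_def)
    \<comment> \<open>Complements are handled by subtraction from the value on the whole space,
      which is open and so covered by \<open>eq\<close>.\<close>
    have Diff: "K (UNIV - A) = K UNIV - K A" if "dual_valued_measure K" for K :: "'a set \<Rightarrow> 'b \<Rightarrow>\<^sub>L real"
      using dual_valued_measure_Un[OF that A, of "UNIV - A"] A by (simp add: Un_Diff_cancel)
    show ?case using Diff[OF M] Diff[OF N] compl eq[of UNIV] by simp
  next
    case (union A)
    then have "range A \<subseteq> sets borel" by (simp add: borel_def)
    then show ?case
      using dual_valued_measure_sums[OF M, of A] dual_valued_measure_sums[OF N, of A] union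
      by (simp add: sums_unique2)
  qed (simp_all add: eq)
qed

section \<open>Recovery of a local vector measure from its value on the whole space\<close>

context normed_function_module
begin

text \<open>Weak locality speaks of open sets only, and \<open>- A\<close> is closed. But
  \<open>N (- A)\<close> is the difference of the values on the open sets \<open>- fsupp f\<close>
  and \<open>A - fsupp f\<close>, both of which annihilate \<open>smul f v\<close>.\<close>

lemma local_vector_measure_apply_smul:
  assumes N: "local_vector_measure R smul N" and f: "f \<in> R" and A: "open A" and supp: "fsupp f \<subseteq> A"
  shows "blinfun_apply (N A) (smul f v) = blinfun_apply (N UNIV) (smul f v)"
proof -
  have dual: "dual_valued_measure N" using N by (simp add: local_vector_measure_def)
  have zero: "blinfun_apply (N B) (smul f v) = 0" if "open B" "B \<inter> fsupp f = {}" for B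
    using N local_norm_smul_eq_zero[OF f that(2)] that(1) by (simp add: local_vector_measure_def)
  have B: "open (A - fsupp f)" "open (- fsupp f)"
    using A by (auto simp: open_Diff open_Compl closed_fsupp)
  have "(A - fsupp f) \<union> - A = - fsupp f" "(A - fsupp f) \<inter> - A = {}" using supp by auto
  then have "N (- fsupp f) = N (A - fsupp f) + N (- A)"
    using dual_valued_measure_Un[OF dual, of "A - fsupp f" "- A"] A B(1) by simp
  moreover have "N UNIV = N A + N (- A)"
    using dual_valued_measure_Un[OF dual, of A "- A"] A by (simp add: Compl_partition)
  moreover have "blinfun_apply (N (A - fsupp f)) (smul f v) = 0" "blinfun_apply (N (- fsupp f)) (smul f v) = 0"
    using B by (auto intro!: zero)
  ultimately show ?thesis by (simp add: blinfun.add_left)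
qed

text \<open>On \<open>{f k > 1/2}\<close> the multiplier \<open>min 1 (2 f k)\<close> equals \<open>1\<close>, so only the mass of \<open>A - {f k > 1/2}\<close>
  contributes to the error.\<close>

lemma local_vector_measure_open_tendsto:
  assumes N: "local_vector_measure R smul N" and A: "open A"
    and f: "\<And>k. f k \<in> R" "\<And>k. fsupp (f k) \<subseteq> A" "\<And>k x. 0 \<le> f k x"
      "\<And>x. incseq (\<lambda>k. f k x)" "\<And>x. (\<lambda>k. f k x) \<longlonglongrightarrow> indicator A x"
  shows "(\<lambda>k. blinfun_apply (N UNIV) (smul (\<lambda>x. min 1 (2 * f k x)) v)) \<longlonglongrightarrow> blinfun_apply (N A) v"
proof -
  have dual: "dual_valued_measure N" using N by (simp add: local_vector_measure_def)
  define p where "p k = (\<lambda>x. min 1 (2 * f k x))" for k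
  define U where "U k = {x. 1/2 < f k x}" for k
  have p: "p k \<in> R" for k
    unfolding p_def by (intro min_mem one_mem cmult_mem f)
  have supp_p: "fsupp (p k) \<subseteq> A" for k
  proof -
    have "fsupp (p k) \<subseteq> fsupp (f k)"
      by (intro fsupp_subsetI closed_fsupp) (simp add: p_def zero_outside_fsupp)
    then show ?thesis using f(2) by blast
  qed
  have U: "open (U k)" for k
    unfolding U_def by (intro open_Collect_less continuous_on_const continuous_mem f)
  have [measurable]: "U k \<in> sets borel" "A \<in> sets borel" for k using U A by auto
  have U_A: "U k \<subseteq> A" for k
  proof
    fix x assume "x \<in> U k"
    then have "f k x \<noteq> 0" by (auto simp: U_def)
    then show "x \<in> A" using zero_outside_fsupp f(2) by blast
  qed
  have "incseq U"
    unfolding U_def incseq_def using f(4) by (auto simp: incseq_def intro: less_le_trans)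
  moreover have "(\<Union>k. U k) = A"
  proof
    show "A \<subseteq> (\<Union>k. U k)"
    proof
      fix x assume "x \<in> A"
      then have "\<forall>\<^sub>F k in sequentially. 1/2 < f k x"
        using f(5)[of x] by (intro order_tendstoD(1)) auto
      then show "x \<in> (\<Union>k. U k)" by (auto simp: U_def dest!: eventually_happens)
    qed
  qed (use U_A in auto)
  moreover have "range U \<subseteq> sets borel" by auto
  ultimately have "(\<lambda>k. N (U k)) \<longlonglongrightarrow> N A"
    using dual_valued_measure_incseq[OF dual, of U] by simp
  then have "(\<lambda>k. norm (N A - N (U k)) * norm v) \<longlonglongrightarrow> norm (N A - N A) * norm v"
    by (intro tendsto_intros)
  then have lim: "(\<lambda>k. norm (N A - N (U k)) * norm v) \<longlonglongrightarrow> 0" by simp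
  have "norm (blinfun_apply (N UNIV) (smul (p k) v) - blinfun_apply (N A) v) \<le> norm (N A - N (U k)) * norm v" for k
  proof -
    let ?w = "smul (\<lambda>x. 1 - p k x) v"
    have mem: "(\<lambda>x. 1 - p k x) \<in> R" by (intro diff_mem one_mem p)
    have "fsupp (\<lambda>x. 1 - p k x) \<subseteq> {x. f k x \<le> 1/2}"
    proof (rule fsupp_subsetI)
      show "closed {x. f k x \<le> 1/2}"
        by (intro closed_Collect_le continuous_on_const continuous_mem f)
    qed (simp add: p_def)
    then have "U k \<inter> fsupp (\<lambda>x. 1 - p k x) = {}" by (auto simp: U_def)
    then have zero: "blinfun_apply (N (U k)) ?w = 0"
      using N U local_norm_smul_eq_zero[OF mem] by (simp add: local_vector_measure_def)
    \<comment> \<open>On \<open>smul (p k) v\<close> the functionals \<open>N A\<close> and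
      \<open>N UNIV\<close> agree, so the error is \<open>N A\<close> applied to the remainder
      \<open>?w\<close>, from which \<open>N (U k)\<close> may be subtracted for free.\<close>
    have "v = smul (p k) v + ?w"
      using smul_add_left[OF p[of k] mem, of v] by (simp add: smul_one)
    then have "blinfun_apply (N A) v = blinfun_apply (N UNIV) (smul (p k) v) + blinfun_apply (N A) ?w"
      using local_vector_measure_apply_smul[OF N p A supp_p] by (metis blinfun.add_right)
    then have "norm (blinfun_apply (N UNIV) (smul (p k) v) - blinfun_apply (N A) v)
        = norm (blinfun_apply (N A - N (U k)) ?w)"
      using zero by (simp add: blinfun.diff_left)
    also have "\<dots> \<le> norm (N A - N (U k)) * norm ?w" by (rule norm_blinfun)
    also have "\<dots> \<le> norm (N A - N (U k)) * norm v"
    proof (rule mult_left_mono)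
      have "\<bar>1 - p k x\<bar> \<le> 1" for x using f(3)[of k x] by (auto simp: p_def)
      then show "norm ?w \<le> norm v" using norm_smul_le'[OF mem, of 1 v] by simp
    qed simp
    finally show ?thesis .
  qed
  then have "(\<lambda>k. blinfun_apply (N UNIV) (smul (p k) v) - blinfun_apply (N A) v) \<longlonglongrightarrow> 0"
    by (intro Lim_null_comparison[OF _ lim] always_eventually) simp
  then show ?thesis unfolding p_def by (rule LIM_zero_cancel)
qed

text \<open>On an open set both measures are limits of expressions in their common value at
  \<open>UNIV\<close>, with the same cut-off functions.\<close>

lemma local_vector_measure_eqI:
  assumes M: "local_vector_measure R smul M" and N: "local_vector_measure R smul N"
    and eq: "M UNIV = N UNIV"
  shows "M = N"
proof (rule dual_valued_measure_eqI)
  show "dual_valued_measure M" "dual_valued_measure N"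
    using M N by (auto simp: local_vector_measure_def)
  fix A :: "'x set" assume A: "open A"
  obtain f where f: "\<And>k. f k \<in> R" "\<And>k. fsupp (f k) \<subseteq> A" "\<And>k x. 0 \<le> f k x" "\<And>k x. f k x \<le> 1"
    "\<And>x. incseq (\<lambda>k. f k x)" "\<And>x. (\<lambda>k. f k x) \<longlonglongrightarrow> indicator A x"
    using open_approximation[OF A] by metis
  show "M A = N A"
  proof (rule blinfun_eqI)
    fix v
    note lim = local_vector_measure_open_tendsto[OF _ A f(1,2,3,5,6), of _ v]
    show "blinfun_apply (M A) v = blinfun_apply (N A) v"
      using LIMSEQ_unique[OF lim[OF M] lim[OF N, folded eq]] .
  qed
qed

end

theorem theorem1p27:
  fixes R :: "('x::polish_space \<Rightarrow> real) set"
    and smul :: "('x \<Rightarrow> real) \<Rightarrow> 'v::real_normed_vector \<Rightarrow> 'v"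
    and F :: "'v \<Rightarrow>\<^sub>L real"
  assumes "normed_function_module R smul"
    and "tight R smul F"
  shows "(\<exists>!N. local_vector_measure R smul N \<and> (\<forall>v. blinfun_apply (N UNIV) v = blinfun_apply F v)) \<and>
    (\<exists>!\<mu>. is_functional_measure R smul F \<mu>) \<and>
    (\<forall>N \<mu>. local_vector_measure R smul N \<and> (\<forall>v. blinfun_apply (N UNIV) v = blinfun_apply F v) \<and>
        is_functional_measure R smul F \<mu> \<longrightarrow>
      (\<forall>E\<in>sets borel. total_variation N E = emeasure \<mu> E))"
proof -
  interpret normed_function_module R smul by fact
  interpret tight_functional R smul F by standard fact
  have unique: "M = N" if "local_vector_measure R smul M" "local_vector_measure R smul N"
    "\<forall>v. blinfun_apply (M UNIV) v = blinfun_apply F v" "\<forall>v. blinfun_apply (N UNIV) v = blinfun_apply F v"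
    for M N
    using local_vector_measure_eqI[OF that(1,2)] blinfun_eqI[of "M UNIV" "N UNIV"] that(3,4) by simp
  \<comment> \<open>The measure is left arbitrary, so the last clause follows for any given pair by
    identifying its vector measure with the one built from its \<open>\<mu>\<close>.\<close>
  have variation: "\<exists>N. local_vector_measure R smul N \<and> (\<forall>v. blinfun_apply (N UNIV) v = blinfun_apply F v) \<and>
      (\<forall>E\<in>sets borel. total_variation N E = emeasure \<mu> E)"
    if "is_functional_measure R smul F \<mu>" for \<mu>
  proof -
    interpret tight_functional_measure R smul F \<mu> by standard fact
    show ?thesis
      using local_vector_measure_N N_UNIV total_variation_N
      by (intro exI[of _ functional_vector_measure]) simp
  qed
  obtain \<mu> where \<mu>: "is_functional_measure R smul F \<mu>" using functional_measure_exists ..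
  show ?thesis
  proof (intro conjI)
    obtain N where "local_vector_measure R smul N \<and> (\<forall>v. blinfun_apply (N UNIV) v = blinfun_apply F v)"
      using variation[OF \<mu>] by auto
    then show "\<exists>!N. local_vector_measure R smul N \<and> (\<forall>v. blinfun_apply (N UNIV) v = blinfun_apply F v)"
      using unique by (intro ex1I[of _ N]) simp_all
    show "\<exists>!\<mu>. is_functional_measure R smul F \<mu>"
      using \<mu> functional_measure_unique[OF _ \<mu>] by (rule ex1I[where a = \<mu>])
    show "\<forall>N \<mu>. local_vector_measure R smul N \<and> (\<forall>v. blinfun_apply (N UNIV) v = blinfun_apply F v) \<and>
        is_functional_measure R smul F \<mu> \<longrightarrow> (\<forall>E\<in>sets borel. total_variation N E = emeasure \<mu> E)"
    proof (intro allI impI)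
      fix N \<nu>
      assume *: "local_vector_measure R smul N \<and> (\<forall>v. blinfun_apply (N UNIV) v = blinfun_apply F v) \<and>
        is_functional_measure R smul F \<nu>"
      then obtain M where M: "local_vector_measure R smul M" "\<forall>v. blinfun_apply (M UNIV) v = blinfun_apply F v"
        "\<forall>E\<in>sets borel. total_variation M E = emeasure \<nu> E"
        using variation[of \<nu>] by auto
      moreover have "M = N" using unique[of M N] M * by simp
      ultimately show "\<forall>E\<in>sets borel. total_variation N E = emeasure \<nu> E" by simp
    qed
  qed
qed

end
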